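(* For every integer $b\ge1$ and every $\varepsilon>0$ there exists $C=C(b,\varepsilon)$ such that, for every $d\ge1$, every graph $G$ on the ordered vertex set $B_d$ having at least $C$ levels $\ell\in\{1,\dots,d\}$ with $d_\ell(G)\ge\frac12+\varepsilon$ contains an ordered copy of $Q_{2,b}$.
   Context: For $d\ge1$, the depth-$d$ binary interval is $B_d=\{0,1\}^d$ with lexicographic order. For $x<y$ in $B_d$ the level is $\delta(x,y)=\min\{i:x_i\ne y_i\}$. The number of pairs $x<y$ in $B_d$ with $\delta(x,y)=\ell$ is $\tau_{\ell,d}=2^{2d-\ell-1}$. For a graph $G$ on $B_d$ (a binary-level graph), $e_\ell(G)$ is the number of edges $xy$ of $G$ ($x<y$) with $\delta(x,y)=\ell$, and $d_\ell(G)=e_\ell(G)/\tau_{\ell,d}$ is the density of level $\ell$. An ordered copy of an ordered graph $F$ in $G$ is an injective, order-preserving map $V(F)\to V(G)$ sending edges to edges (not necessarily induced). For $b\ge1$, $Q_{2,b}$ is the ordered graph on vertices $1<2<\cdots<b+3$ with edges $12,\ 13,\ 23,\ 34,\ 45,\ \ldots,\ (b+2)(b+3)$. *)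

theory Defs
  imports Complex_Main "HOL-Library.List_Lexorder"
begin

definition simple_graph :: "'a set \<Rightarrow> 'a set set \<Rightarrow> bool" where
  "simple_graph V E \<longleftrightarrow> E \<subseteq> {e. e \<subseteq> V \<and> card e = 2}"

definition ordered_copy ::
    "('a::linorder \<Rightarrow> 'b::linorder) \<Rightarrow> 'a set \<Rightarrow> 'a set set \<Rightarrow> 'b set \<Rightarrow> 'b set set \<Rightarrow> bool" where
  "ordered_copy f V E V' E' \<longleftrightarrow>
     f ` V \<subseteq> V' \<and> inj_on f V \<and> mono_on V f \<and> (\<forall>e\<in>E. f ` e \<in> E')"

definition contains_ordered_copy ::
    "'b::linorder set \<Rightarrow> 'b set set \<Rightarrow> 'a::linorder set \<Rightarrow> 'a set set \<Rightarrow> bool" where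
  "contains_ordered_copy V' E' V E \<longleftrightarrow> (\<exists>f. ordered_copy f V E V' E')"

(* The digits 0 and 1 are False < True; the order on lists is the lexicographic one
   from List_Lexorder. *)
definition binary_interval :: "nat \<Rightarrow> bool list set" where
  "binary_interval d = {x. length x = d}"

(* Coordinates, hence levels, are numbered from 1, whereas list positions start at 0. *)
definition level :: "bool list \<Rightarrow> bool list \<Rightarrow> nat" where
  "level x y = (LEAST i. 1 \<le> i \<and> i \<le> length x \<and> x ! (i - 1) \<noteq> y ! (i - 1))"

definition level_pairs :: "nat \<Rightarrow> nat \<Rightarrow> (bool list \<times> bool list) set" where
  "level_pairs l d =
     {(x, y). x \<in> binary_interval d \<and> y \<in> binary_interval d \<and> x < y \<and> level x y = l}"

definition tau :: "nat \<Rightarrow> nat \<Rightarrow> nat" where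
  "tau l d = card (level_pairs l d)"

definition level_edges :: "nat \<Rightarrow> nat \<Rightarrow> bool list set set \<Rightarrow> nat" where
  "level_edges l d E = card {(x, y). (x, y) \<in> level_pairs l d \<and> {x, y} \<in> E}"

definition level_density :: "nat \<Rightarrow> nat \<Rightarrow> bool list set set \<Rightarrow> real" where
  "level_density l d E = real (level_edges l d E) / real (tau l d)"

definition Q2_verts :: "nat \<Rightarrow> nat set" where
  "Q2_verts b = {1..b + 3}"

definition Q2_edges :: "nat \<Rightarrow> nat set set" where
  "Q2_edges b = {{1, 2}, {1, 3}, {2, 3}} \<union> {{i, i + 1} | i. 3 \<le> i \<and> i \<le> b + 2}"

lemma level_append:
  assumes "a \<noteq> c"
  shows "level (u @ a # v) (u @ c # w) = Suc (length u)"
  unfolding level_def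
proof (rule Least_equality)
  fix i assume i: "1 \<le> i \<and> i \<le> length (u @ a # v) \<and> (u @ a # v) ! (i - 1) \<noteq> (u @ c # w) ! (i - 1)"
  show "Suc (length u) \<le> i"
  proof (rule ccontr)
    assume "\<not> Suc (length u) \<le> i"
    with i have "i - 1 < length u" by linarith
    with i show False by (simp add: nth_append)
  qed
qed (use assms in simp)

lemma level_pairs_eq:
  assumes "1 \<le> l" "l \<le> d"
  shows "level_pairs l d = (\<lambda>(u, v, w). (u @ False # v, u @ True # w)) `
     ({u. length u = l - 1} \<times> {v. length v = d - l} \<times> {w. length w = d - l})"
    (is "_ = ?f ` ?S")
proof (intro equalityI subsetI)
  fix p assume "p \<in> level_pairs l d"
  then obtain x y where p: "p = (x, y)" and len: "length x = d" "length y = d"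
    and less: "x < y" and lev: "level x y = l"
    by (auto simp: level_pairs_def binary_interval_def)
  from less have "(\<exists>a v. y = x @ a # v) \<or>
      (\<exists>u a c v w. a < c \<and> x = u @ a # v \<and> y = u @ c # w)"
    by (simp add: list_less_def lexord_def)
  then obtain u a c v w where ac: "a < c" and x: "x = u @ a # v" and y: "y = u @ c # w"
    using len by auto
  from lev ac x y have "Suc (length u) = l" using level_append[of a c u v w] by auto
  moreover have "\<not> a" "c" using ac by auto
  ultimately show "p \<in> ?f ` ?S"
    using p x y len by (intro image_eqI[of _ _ "(u, v, w)"]) auto
next
  fix p assume "p \<in> ?f ` ?S"
  then obtain u v w where p: "p = (u @ False # v, u @ True # w)"
    and len: "length u = l - 1" "length v = d - l" "length w = d - l" by auto
  have "u @ False # v < u @ True # w"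
    by (auto simp: list_less_def lexord_def)
  then show "p \<in> level_pairs l d"
    using len assms p by (simp add: level_pairs_def binary_interval_def level_append)
qed

lemma tau_eq:
  assumes "1 \<le> l" "l \<le> d"
  shows "tau l d = 2 ^ (2 * d - l - 1)"
proof -
  have lists: "card {x::bool list. length x = n} = 2 ^ n" for n
    using card_lists_length_eq[of "UNIV::bool set" n] by (simp add: card_UNIV_bool)
  have "tau l d = 2 ^ (l - 1) * (2 ^ (d - l) * 2 ^ (d - l))"
    unfolding tau_def level_pairs_eq[OF assms]
    by (subst card_image) (auto simp: inj_on_def card_cartesian_product lists)
  also have "\<dots> = 2 ^ (l - 1 + (d - l) + (d - l))" by (simp add: power_add)
  also have "l - 1 + (d - l) + (d - l) = 2 * d - l - 1" using assms by linarith
  finally show ?thesis .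
qed

end

theory Submission
  imports Defs
begin

text \<open>
  Label a vertex \<open>x\<close> by the length of the longest increasing path starting at \<open>x\<close>, capped at \<open>b\<close>, and
  let \<open>A\<close> be the set of vertices with label \<open>b\<close>. Without an ordered copy of the graph, an edge
  \<open>x < y\<close> either drops the label strictly or lies inside \<open>A\<close>, and \<open>A\<close> spans no triangle, because
  the last vertex of a triangle must not start a path with \<open>b\<close> edges. If the labels of the
  two halves of a subtree had exactly the same distribution, with a proportion \<open>\<alpha>\<close> in \<open>A\<close>,
  the label-dropping pairs would have density at most \<open>(1 - \<alpha>\<^sup>2) / 2\<close> by symmetry. It then remains to see that
  the triangle-free graph on \<open>A\<close> has density at most \<open>\<alpha>\<^sup>2 / 2\<close> on a typical level, so that no more
  than \<open>1 / 2\<close> is available in total.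

  The labels are made equidistributed by an energy increment argument (\<open>exists_stable_subtree\<close>).
  The mean square of the conditional densities of the labels, given the first \<open>m\<close> digits, increases
  with \<open>m\<close> and is bounded; so among many dense levels there is a long block along which it hardly grows,
  and below some vertex of the tree at the start of this block all label densities are almost constant while the levels of
  the block are still dense on average.

  The bound for triangle-free graphs imitates the following proof that a loopless directed graph on \<open>N\<close> vertices without
  transitive triangles has at most \<open>N\<^sup>2 / 2\<close> arcs. For an arc from \<open>x\<close> to \<open>y\<close>, no \<open>w\<close> is both an out-neighbour
  of \<open>x\<close> and an in-neighbour of \<open>y\<close>; summing \<open>outdeg x + indeg y \<le> N\<close> over all arcs bounds the sum
  of the squares of all out- and in-degrees, and the Cauchy-Schwarz inequality does the rest.
  In the tree, take two levels \<open>i < j\<close>, an edge \<open>x y\<close> on level \<open>i\<close>, and \<open>w\<close> branching off from \<open>x\<close>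
  to the right on level \<open>j\<close>, so that \<open>x < w < y\<close> (\<open>degree_product_local\<close>). The sum of squares of out-degrees becomes the
  mean of the product of the forward degrees of \<open>x\<close> on the levels \<open>i\<close> and \<open>j\<close>. Averaged over
  all pairs of levels, this product is essentially as large as if all forward degrees were equal to their mean on \<open>A\<close>,
  because the square of their sum dominates a tangent line. The in-degrees of \<open>y\<close> into the two sibling subtrees
  containing \<open>x\<close> and \<open>w\<close> agree for most pairs of levels, by a second
  energy argument (\<open>sum_gap_le\<close>). This yields \<open>sum_tree_density_triangle_free\<close>.
\<close>

section \<open>Averages over binary strings\<close>

text \<open>
  Defined by recursion on the digits rather than as a normalised sum, so that linearity, monotonicity,
  Fubini and the tower law are inductions on the depth.
\<close>

primrec mean :: "nat \<Rightarrow> (bool list \<Rightarrow> real) \<Rightarrow> real" where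
  "mean 0 F = F []"
| "mean (Suc n) F = (mean n (\<lambda>x. F (False # x)) + mean n (\<lambda>x. F (True # x))) / 2"

lemma mean_cong:
  "(\<And>x. length x = n \<Longrightarrow> F x = G x) \<Longrightarrow> mean n F = mean n G"
proof (induction n arbitrary: F G)
  case (Suc n)
  have "mean n (\<lambda>x. F (c # x)) = mean n (\<lambda>x. G (c # x))" for c
    by (rule Suc.IH) (simp add: Suc.prems)
  then show ?case by simp
qed simp

lemma mean_mono:
  "(\<And>x. length x = n \<Longrightarrow> F x \<le> G x) \<Longrightarrow> mean n F \<le> mean n G"
proof (induction n arbitrary: F G)
  case (Suc n)
  have "mean n (\<lambda>x. F (c # x)) \<le> mean n (\<lambda>x. G (c # x))" for c
    by (rule Suc.IH) (simp add: Suc.prems)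
  from this[of True] this[of False] show ?case by simp
qed simp

lemma mean_const [simp]: "mean n (\<lambda>x. c) = c"
  by (induction n) auto

lemma mean_add: "mean n (\<lambda>x. F x + G x) = mean n F + mean n G"
  by (induction n arbitrary: F G) (auto simp: field_simps)

lemma mean_diff: "mean n (\<lambda>x. F x - G x) = mean n F - mean n G"
  by (induction n arbitrary: F G) (simp_all add: diff_divide_distrib add_divide_distrib)

lemma mean_cmult: "mean n (\<lambda>x. c * F x) = c * mean n F"
  by (induction n arbitrary: F) (auto simp: field_simps)

lemma mean_multc: "mean n (\<lambda>x. F x * c) = mean n F * c"
  by (induction n arbitrary: F) (auto simp: field_simps)

lemma mean_divc: "mean n (\<lambda>x. F x / c) = mean n F / c"
  using mean_multc[of n F "inverse c"] by (simp add: field_simps)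

lemma mean_sum: "mean n (\<lambda>x. \<Sum>i\<in>S. F i x) = (\<Sum>i\<in>S. mean n (F i))"
  by (induction S rule: infinite_finite_induct) (auto simp: mean_add)

lemma mean_swap: "mean m (\<lambda>x. mean n (\<lambda>y. F x y)) = mean n (\<lambda>y. mean m (\<lambda>x. F x y))"
  by (induction m arbitrary: F) (simp_all add: mean_add mean_divc)

lemma mean_append: "mean (m + n) F = mean m (\<lambda>u. mean n (\<lambda>x. F (u @ x)))"
  by (induction m arbitrary: F) simp_all

lemma mean_snoc: "mean (Suc m) F = mean m (\<lambda>u. (F (u @ [False]) + F (u @ [True])) / 2)"
  using mean_append[of m 1 F] by simp

lemma mean_nonneg: "(\<And>x. length x = n \<Longrightarrow> 0 \<le> F x) \<Longrightarrow> 0 \<le> mean n F"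
  using mean_mono[of n "\<lambda>_. 0" F] by simp

lemma mean_le_const: "(\<And>x. length x = n \<Longrightarrow> F x \<le> c) \<Longrightarrow> mean n F \<le> c"
  using mean_mono[of n F "\<lambda>_. c"] by simp

lemma mean_ge_witness:
  assumes "c \<le> mean n F"
  shows "\<exists>x. length x = n \<and> c \<le> F x"
  using assms
proof (induction n arbitrary: F)
  case (Suc n)
  then have "c \<le> mean n (\<lambda>x. F (False # x)) \<or> c \<le> mean n (\<lambda>x. F (True # x))"
    by (auto simp: field_simps)
  then show ?case
  proof
    assume "c \<le> mean n (\<lambda>x. F (False # x))"
    from Suc.IH[OF this] show ?thesis by (metis length_Cons)
  next
    assume "c \<le> mean n (\<lambda>x. F (True # x))"
    from Suc.IH[OF this] show ?thesis by (metis length_Cons)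
  qed
qed simp

lemma mean_power2_le: "(mean n F)\<^sup>2 \<le> mean n (\<lambda>x. (F x)\<^sup>2)"
proof -
  have "0 \<le> mean n (\<lambda>x. (F x - mean n F)\<^sup>2)" by (rule mean_nonneg) simp
  also have "\<dots> = mean n (\<lambda>x. (F x)\<^sup>2) - (mean n F)\<^sup>2"
    by (simp add: power2_diff mean_add mean_diff mean_multc mean_cmult)
       (simp add: power2_eq_square)
  finally show ?thesis by simp
qed

lemma mean_abs_le:
  assumes "mean n (\<lambda>x. (F x)\<^sup>2) \<le> r\<^sup>2" "0 \<le> r"
  shows "mean n (\<lambda>x. \<bar>F x\<bar>) \<le> r"
proof -
  have "(mean n (\<lambda>x. \<bar>F x\<bar>))\<^sup>2 \<le> r\<^sup>2"
    using mean_power2_le[of n "\<lambda>x. \<bar>F x\<bar>"] assms by simp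
  then show ?thesis using assms(2) by (rule power2_le_imp_le)
qed

lemma mean_eq_sum: "mean n F = (\<Sum>x\<in>{x. length x = n}. F x) / 2 ^ n"
proof (induction n arbitrary: F)
  case (Suc n)
  let ?L = "\<lambda>n. {x :: bool list. length x = n}"
  have fin: "finite (?L n)" for n using finite_lists_length_eq[of "UNIV :: bool set" n] by simp
  have eq: "?L (Suc n) = (#) False ` ?L n \<union> (#) True ` ?L n"
    by (auto simp: length_Suc_conv image_iff)
  have "sum F (?L (Suc n)) = sum F ((#) False ` ?L n) + sum F ((#) True ` ?L n)"
    unfolding eq by (rule sum.union_disjoint) (auto simp: fin)
  also have "\<dots> = (\<Sum>x\<in>?L n. F (False # x)) + (\<Sum>x\<in>?L n. F (True # x))"
    by (subst (1 2) sum.reindex) auto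
  finally show ?case by (simp add: Suc.IH field_simps)
qed simp

text \<open>
  The average over the leaves, at depth \<open>n\<close>, of the subtree rooted at \<open>u\<close>: the conditional
  expectation of \<open>F\<close> given that a random string of length \<open>n\<close> starts with \<open>u\<close>.
\<close>

definition cmean :: "nat \<Rightarrow> (bool list \<Rightarrow> real) \<Rightarrow> bool list \<Rightarrow> real" where
  "cmean n F u = mean (n - length u) (\<lambda>x. F (u @ x))"

lemma cmean_Nil: "cmean n F [] = mean n F"
  by (simp add: cmean_def)

lemma cmean_cong:
  "(\<And>x. length x = n - length u \<Longrightarrow> F (u @ x) = G (u @ x)) \<Longrightarrow> cmean n F u = cmean n G u"
  unfolding cmean_def by (rule mean_cong)

lemma cmean_split:
  assumes "length u < n"
  shows "cmean n F u = (cmean n F (u @ [False]) + cmean n F (u @ [True])) / 2"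
proof -
  from assms have "n - length u = Suc (n - Suc (length u))" by simp
  then show ?thesis by (simp add: cmean_def)
qed

lemma mean_cmean:
  assumes "m \<le> n"
  shows "mean m (cmean n F) = mean n F"
proof -
  have "mean m (cmean n F) = mean m (\<lambda>u. mean (n - m) (\<lambda>x. F (u @ x)))"
    by (rule mean_cong) (simp add: cmean_def)
  also have "\<dots> = mean n F" using mean_append[of m "n - m" F] assms by simp
  finally show ?thesis .
qed

lemma cmean_bounds:
  assumes "\<And>x. 0 \<le> F x" "\<And>x. F x \<le> 1"
  shows "0 \<le> cmean n F u" "cmean n F u \<le> 1"
  using assms by (auto simp: cmean_def intro: mean_nonneg mean_le_const)

text \<open>
  The energy increment: conditional means form a martingale, and the average of two squares exceeds the square
  of the average by a quarter of the squared difference.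
\<close>

lemma mean_cmean_power2_Suc:
  assumes "m < n"
  shows "mean (Suc m) (\<lambda>u. (cmean n F u)\<^sup>2) = mean m (\<lambda>u. (cmean n F u)\<^sup>2)
     + mean m (\<lambda>u. (cmean n F (u @ [False]) - cmean n F (u @ [True]))\<^sup>2) / 4"
proof -
  have "mean (Suc m) (\<lambda>u. (cmean n F u)\<^sup>2) = mean m (\<lambda>u. (cmean n F u)\<^sup>2
     + (cmean n F (u @ [False]) - cmean n F (u @ [True]))\<^sup>2 / 4)"
    unfolding mean_snoc
    by (rule mean_cong) (use assms in \<open>simp add: cmean_split power2_eq_square field_simps\<close>)
  then show ?thesis by (simp add: mean_add mean_divc)
qed

lemma mean_cmean_power2_mono:
  assumes "m \<le> m'" "m' \<le> n"
  shows "mean m (\<lambda>u. (cmean n F u)\<^sup>2) \<le> mean m' (\<lambda>u. (cmean n F u)\<^sup>2)"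
  using assms
proof (induction m' rule: dec_induct)
  case (step m')
  have "0 \<le> mean m' (\<lambda>u. (cmean n F (u @ [False]) - cmean n F (u @ [True]))\<^sup>2)"
    by (rule mean_nonneg) simp
  with step show ?case by (simp add: mean_cmean_power2_Suc del: mean.simps)
qed simp

text \<open>
  The increments telescope, and the energy of a function with values between 0 and 1 is at most 1. So
  there are few levels on which the two halves of a typical subtree have different means.
\<close>

lemma sum_sibling_gaps_le:
  assumes "\<And>x. 0 \<le> F x" "\<And>x. F x \<le> 1"
  shows "(\<Sum>j<n. mean j (\<lambda>u. (cmean n F (u @ [False]) - cmean n F (u @ [True]))\<^sup>2)) \<le> 4"
proof -
  let ?g = "\<lambda>j. mean j (\<lambda>u. (cmean n F u)\<^sup>2)"
  have "(\<Sum>j<n. mean j (\<lambda>u. (cmean n F (u @ [False]) - cmean n F (u @ [True]))\<^sup>2))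
      = (\<Sum>j<n. 4 * (?g (Suc j) - ?g j))"
    by (rule sum.cong) (auto simp: mean_cmean_power2_Suc simp del: mean.simps)
  also have "\<dots> = 4 * (?g n - ?g 0)"
    using sum_lessThan_telescope[of "\<lambda>j. 4 * ?g j" n] by (simp del: mean.simps)
  also have "\<dots> \<le> 4"
  proof -
    have "?g n \<le> 1"
      by (rule mean_le_const) (simp add: cmean_bounds assms power_le_one)
    moreover have "0 \<le> ?g 0" by simp
    ultimately have "?g n - ?g 0 \<le> 1" by linarith
    then show ?thesis by (simp del: mean.simps)
  qed
  finally show ?thesis .
qed

section \<open>Densities and forward degrees of levels\<close>

lemma append_False_less_append_True: "u @ False # x < u @ True # (y :: bool list)"
  by (auto simp: list_less_def lexord_def)

text \<open>
  The density of level \<open>i + 1\<close> in a tree of depth \<open>n\<close>. Levels are numbered from 0 here, so that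
  \<open>i\<close> is the length of the common prefix.
\<close>

definition tree_density :: "nat \<Rightarrow> (bool list \<Rightarrow> bool list \<Rightarrow> bool) \<Rightarrow> nat \<Rightarrow> real" where
  "tree_density n e i =
     mean i (\<lambda>u. cmean n (\<lambda>x. cmean n (\<lambda>y. of_bool (e x y)) (u @ [True])) (u @ [False]))"

text \<open>
  The density of the neighbours of \<open>x\<close> that branch off to the right at position \<open>i\<close>. It is 0 if \<open>x\<close>
  itself goes to the right there, hence its mean is only half of the level density.
\<close>

definition fwd_degree :: "nat \<Rightarrow> (bool list \<Rightarrow> bool list \<Rightarrow> bool) \<Rightarrow> nat \<Rightarrow> bool list \<Rightarrow> real" where
  "fwd_degree n e i x =
     (if x ! i then 0 else cmean n (\<lambda>y. of_bool (e x y)) (take i x @ [True]))"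

lemma fwd_degree_bounds: "0 \<le> fwd_degree n e i x" "fwd_degree n e i x \<le> 1"
  by (auto simp: fwd_degree_def cmean_bounds)

lemma mean_fwd_degree:
  assumes "i < n"
  shows "mean n (fwd_degree n e i) = tree_density n e i / 2"
proof -
  have "mean n (fwd_degree n e i) = mean (Suc i) (cmean n (fwd_degree n e i))"
    using assms by (simp add: mean_cmean del: mean.simps)
  also have "\<dots> = mean i (\<lambda>u. cmean n (\<lambda>x. cmean n (\<lambda>y. of_bool (e x y)) (u @ [True])) (u @ [False]) / 2)"
    unfolding mean_snoc
  proof (rule mean_cong)
    fix u :: "bool list" assume u: "length u = i"
    have "cmean n (fwd_degree n e i) (u @ [True]) = cmean n (\<lambda>_. 0) (u @ [True])"
      by (rule cmean_cong) (use u in \<open>simp add: fwd_degree_def nth_append\<close>)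
    moreover have "cmean n (fwd_degree n e i) (u @ [False])
        = cmean n (\<lambda>x. cmean n (\<lambda>y. of_bool (e x y)) (u @ [True])) (u @ [False])"
      by (rule cmean_cong) (use u in \<open>simp add: fwd_degree_def nth_append\<close>)
    ultimately show "(cmean n (fwd_degree n e i) (u @ [False]) + cmean n (fwd_degree n e i) (u @ [True])) / 2
        = cmean n (\<lambda>x. cmean n (\<lambda>y. of_bool (e x y)) (u @ [True])) (u @ [False]) / 2"
      by (simp add: cmean_def)
  qed
  also have "\<dots> = tree_density n e i / 2"
    by (simp add: tree_density_def mean_divc)
  finally show ?thesis .
qed

section \<open>Triangle-free graphs\<close>

text \<open>
  Here \<open>x\<close>, \<open>w\<close>, \<open>y\<close> range over three separate subtrees and \<open>E1\<close>, \<open>E2\<close>, \<open>E3\<close> are the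
  edge indicators between them. The hypothesis says that, if \<open>x y\<close> is an edge, then \<open>w\<close> is joined to at most
  one of the two, and to none unless it lies in \<open>A\<close>. Summing over \<open>w\<close> is the inequality
  \<open>outdeg x + indeg y \<le> |A|\<close>, which is then summed over the edges \<open>x y\<close>.
\<close>

lemma mean_triangle_le:
  assumes "\<And>x w y. E1 x y * (E2 x w + E3 w y) \<le> E1 x y * A w"
  shows "mean N (\<lambda>x. mean M (E1 x) * mean K (E2 x))
     + mean M (\<lambda>y. mean N (\<lambda>x. E1 x y) * mean K (\<lambda>w. E3 w y))
     \<le> mean M (\<lambda>y. mean N (\<lambda>x. E1 x y)) * mean K A"
proof -
  have "mean M (\<lambda>y. mean N (\<lambda>x. mean K (\<lambda>w. E1 x y * (E2 x w + E3 w y))))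
      \<le> mean M (\<lambda>y. mean N (\<lambda>x. mean K (\<lambda>w. E1 x y * A w)))"
    by (intro mean_mono assms)
  also have "\<dots> = mean M (\<lambda>y. mean N (\<lambda>x. E1 x y)) * mean K A"
    by (simp add: mean_cmult mean_multc)
  also have "mean M (\<lambda>y. mean N (\<lambda>x. mean K (\<lambda>w. E1 x y * (E2 x w + E3 w y))))
      = mean M (\<lambda>y. mean N (\<lambda>x. E1 x y * mean K (E2 x)))
        + mean M (\<lambda>y. mean N (\<lambda>x. mean K (\<lambda>w. E1 x y * E3 w y)))"
    by (simp add: distrib_left mean_add mean_cmult)
  also have "mean M (\<lambda>y. mean N (\<lambda>x. E1 x y * mean K (E2 x)))
      = mean N (\<lambda>x. mean M (E1 x) * mean K (E2 x))"
    by (subst mean_swap) (simp add: mean_multc)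
  also have "mean M (\<lambda>y. mean N (\<lambda>x. mean K (\<lambda>w. E1 x y * E3 w y)))
      = mean M (\<lambda>y. mean N (\<lambda>x. E1 x y) * mean K (\<lambda>w. E3 w y))"
    by (simp add: mean_cmult mean_multc)
  finally show ?thesis .
qed

lemma power2_sum_eq_pairs:
  fixes g :: "nat \<Rightarrow> real"
  assumes "finite I"
  shows "(\<Sum>i\<in>I. g i)\<^sup>2 = (\<Sum>i\<in>I. (g i)\<^sup>2) + 2 * (\<Sum>i\<in>I. \<Sum>j\<in>{j\<in>I. i < j}. g i * g j)"
  using assms
proof (induction I rule: finite_linorder_max_induct)
  case (insert m I)
  have m: "m \<notin> I" using insert.hyps by auto
  have "(\<Sum>i\<in>insert m I. \<Sum>j\<in>{j\<in>insert m I. i < j}. g i * g j)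
      = (\<Sum>i\<in>I. \<Sum>j\<in>insert m {j\<in>I. i < j}. g i * g j)"
  proof -
    have "{j \<in> insert m I. m < j} = {}" using insert.hyps by auto
    then have "(\<Sum>j\<in>{j \<in> insert m I. m < j}. g m * g j) = 0" by (simp only: sum.empty)
    moreover have "{j \<in> insert m I. i < j} = insert m {j\<in>I. i < j}" if "i \<in> I" for i
      using insert.hyps that by auto
    ultimately show ?thesis using insert.hyps(1) m by (simp del: insert_iff)
  qed
  also have "\<dots> = (\<Sum>i\<in>I. g i) * g m + (\<Sum>i\<in>I. \<Sum>j\<in>{j\<in>I. i < j}. g i * g j)"
    using insert.hyps(1) m by (simp add: sum.distrib sum_distrib_right)
  finally show ?case
    using insert.IH insert.hyps(1) m by (simp add: power2_sum algebra_simps)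
qed simp

context
  fixes n :: nat and e :: "bool list \<Rightarrow> bool list \<Rightarrow> bool" and a :: "bool list \<Rightarrow> bool"
  assumes verts: "\<And>x y. e x y \<Longrightarrow> a x \<and> a y"
    and triangle_free: "\<And>x w y. x < w \<Longrightarrow> w < y \<Longrightarrow> e x w \<Longrightarrow> e w y \<Longrightarrow> \<not> e x y"
begin

abbreviation (input) dens :: "bool list \<Rightarrow> real" where
  "dens u \<equiv> cmean n (\<lambda>x. of_bool (a x)) u"

abbreviation (input) \<alpha> :: real where
  "\<alpha> \<equiv> dens []"

abbreviation (input) bdeg :: "bool list \<Rightarrow> bool list \<Rightarrow> real" where
  "bdeg y u \<equiv> cmean n (\<lambda>x. of_bool (e x y)) u"

text \<open>
  How much the densities of the neighbours of \<open>y\<close> in two sibling subtrees with roots at depth \<open>j + 1\<close> differ on average, where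
  \<open>y\<close> branches off to the right at position \<open>i < j\<close>.
\<close>

definition gap :: "nat \<Rightarrow> nat \<Rightarrow> real" where
  "gap i j = mean j (\<lambda>P. if P ! i then 0
     else cmean n (\<lambda>y. \<bar>bdeg y (P @ [False]) - bdeg y (P @ [True])\<bar>) (take i P @ [True]))"

text \<open>
  The sum of squares of in-degrees would be the mean of \<open>g0 y * g1 y\<close>, where \<open>g0\<close> and \<open>g1\<close> are the degrees
  of \<open>y\<close> into the left and right half of the subtree at \<open>P\<close>. If these agree, and if the density of
  \<open>A\<close> in the right half is \<open>\<alpha>\<close>, then \<open>g0 y * (\<alpha> - g1 y) \<le> \<alpha>\<^sup>2 / 4\<close>, and only the \<open>y\<close> in \<open>A\<close> contribute.
  The further summands are the errors made by these replacements and by taking \<open>\<alpha>\<close> for the density of \<open>A\<close> around \<open>y\<close>.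
\<close>

lemma degree_product_local:
  assumes "i < length P" "\<not> P ! i"
  defines "Q \<equiv> take i P @ [True]"
  shows "cmean n (\<lambda>x. fwd_degree n e i x * fwd_degree n e (length P) x) (P @ [False])
     \<le> \<alpha> ^ 3 / 4 + \<bar>dens Q - \<alpha>\<bar> + \<bar>dens (P @ [True]) - \<alpha>\<bar>
        + cmean n (\<lambda>y. \<bar>bdeg y (P @ [False]) - bdeg y (P @ [True])\<bar>) Q"
proof -
  let ?g0 = "\<lambda>y. bdeg y (P @ [False])" and ?g1 = "\<lambda>y. bdeg y (P @ [True])"
  have \<alpha>: "0 \<le> \<alpha>" "\<alpha> \<le> 1" by (simp_all add: cmean_bounds)
  have P: "take i P @ False # drop (Suc i) P = P"
    using id_take_nth_drop[OF assms(1)] assms(2) by simp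
  have "cmean n (\<lambda>x. fwd_degree n e i x * fwd_degree n e (length P) x) (P @ [False])
      = cmean n (\<lambda>x. cmean n (\<lambda>y. of_bool (e x y)) Q * cmean n (\<lambda>w. of_bool (e x w)) (P @ [True]))
          (P @ [False])"
    by (rule cmean_cong) (use assms in \<open>simp add: fwd_degree_def nth_append\<close>)
  also have "\<dots> \<le> cmean n ?g0 Q * dens (P @ [True]) - cmean n (\<lambda>y. ?g0 y * ?g1 y) Q"
  proof -
    have "of_bool (e (P @ False # x) (take i P @ True # y))
          * (of_bool (e (P @ False # x) (P @ True # w)) + of_bool (e (P @ True # w) (take i P @ True # y)))
        \<le> (of_bool (e (P @ False # x) (take i P @ True # y)) * of_bool (a (P @ True # w)) :: real)"
      for x w y
    proof -
      have "P @ False # x < P @ True # w" by (rule append_False_less_append_True)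
      moreover have "P @ True # w < take i P @ True # y"
        using append_False_less_append_True[of "take i P" "drop (Suc i) P @ True # w" y]
        by (simp only: P append_Cons[symmetric] append_assoc[symmetric])
      ultimately show ?thesis
        using triangle_free[of "P @ False # x" "P @ True # w" "take i P @ True # y"]
          verts[of "P @ False # x" "P @ True # w"] verts[of "P @ True # w" "take i P @ True # y"]
        by auto
    qed
    from mean_triangle_le[of "\<lambda>x y. of_bool (e (P @ False # x) (take i P @ True # y))"
        "\<lambda>x w. of_bool (e (P @ False # x) (P @ True # w))"
        "\<lambda>w y. of_bool (e (P @ True # w) (take i P @ True # y))"
        "\<lambda>w. of_bool (a (P @ True # w))", OF this]
    show ?thesis unfolding cmean_def Q_def by (simp add: algebra_simps)
  qed
  also have "\<dots> = cmean n (\<lambda>y. ?g0 y * (dens (P @ [True]) - ?g1 y)) Q"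
    unfolding cmean_def[of n _ Q] by (simp add: mean_diff mean_multc right_diff_distrib)
  also have "\<dots> \<le> cmean n (\<lambda>y. of_bool (a y) * (\<alpha>\<^sup>2 / 4) + \<bar>dens (P @ [True]) - \<alpha>\<bar> + \<bar>?g0 y - ?g1 y\<bar>) Q"
    unfolding cmean_def[of n _ Q]
  proof (rule mean_mono)
    fix z :: "bool list"
    let ?y = "Q @ z"
    have g0: "0 \<le> ?g0 ?y" "?g0 ?y \<le> 1" by (simp_all add: cmean_bounds)
    have "?g0 ?y * (\<alpha> - ?g0 ?y) \<le> of_bool (a ?y) * (\<alpha>\<^sup>2 / 4)"
    proof (cases "a ?y")
      case True
      have "0 \<le> (\<alpha> / 2 - ?g0 ?y)\<^sup>2" by simp
      then show ?thesis using True by (simp add: power2_eq_square algebra_simps)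
    next
      case False
      then have "\<not> e x ?y" for x using verts by blast
      then show ?thesis using False by (simp add: cmean_def)
    qed
    moreover have "?g0 ?y * (dens (P @ [True]) - \<alpha>) \<le> \<bar>dens (P @ [True]) - \<alpha>\<bar>"
      using g0 by (smt (verit) mult_left_le_one_le mult_left_mono)
    moreover have "?g0 ?y * (?g0 ?y - ?g1 ?y) \<le> \<bar>?g0 ?y - ?g1 ?y\<bar>"
      using g0 by (smt (verit) mult_left_le_one_le mult_left_mono)
    ultimately show "?g0 ?y * (dens (P @ [True]) - ?g1 ?y)
        \<le> of_bool (a ?y) * (\<alpha>\<^sup>2 / 4) + \<bar>dens (P @ [True]) - \<alpha>\<bar> + \<bar>?g0 ?y - ?g1 ?y\<bar>"
      by (simp only: right_diff_distrib)
  qed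
  also have "\<dots> = dens Q * (\<alpha>\<^sup>2 / 4) + \<bar>dens (P @ [True]) - \<alpha>\<bar> + cmean n (\<lambda>y. \<bar>?g0 y - ?g1 y\<bar>) Q"
    unfolding cmean_def[of n _ Q] by (simp only: mean_add mean_multc mean_const)
  also have "dens Q * (\<alpha>\<^sup>2 / 4) \<le> \<alpha> ^ 3 / 4 + \<bar>dens Q - \<alpha>\<bar>"
  proof -
    have "\<alpha>\<^sup>2 / 4 \<le> 1" "0 \<le> \<alpha>\<^sup>2 / 4" using \<alpha> power_le_one[of \<alpha> 2] by auto
    then have "(dens Q - \<alpha>) * (\<alpha>\<^sup>2 / 4) \<le> \<bar>dens Q - \<alpha>\<bar>"
      by (smt (verit) mult_left_le mult_right_mono)
    then show ?thesis by (simp add: power3_eq_cube power2_eq_square algebra_simps)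
  qed
  finally show ?thesis by simp
qed

lemma mean_right_child_le:
  assumes "mean (Suc j) (\<lambda>u. \<bar>dens u - \<alpha>\<bar>) \<le> \<delta>"
  shows "mean j (\<lambda>u. \<bar>dens (u @ [True]) - \<alpha>\<bar>) \<le> 2 * \<delta>"
proof -
  have "mean j (\<lambda>u. \<bar>dens (u @ [True]) - \<alpha>\<bar>) / 2 \<le> mean (Suc j) (\<lambda>u. \<bar>dens u - \<alpha>\<bar>)"
    unfolding mean_snoc mean_divc[symmetric] by (rule mean_mono) simp
  then show ?thesis using assms by linarith
qed

lemma mean_take:
  assumes "i \<le> j"
  shows "mean j (\<lambda>P. F (take i P)) = mean i F"
proof -
  have "mean j (\<lambda>P. F (take i P)) = mean (i + (j - i)) (\<lambda>P. F (take i P))" using assms by simp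
  also have "\<dots> = mean i (\<lambda>u. mean (j - i) (\<lambda>x. F u))"
    unfolding mean_append by (rule mean_cong) simp
  finally show ?thesis by simp
qed

lemma mean_nth_False:
  assumes "i < j"
  shows "mean j (\<lambda>P. if P ! i then 0 else c) = c / 2"
proof -
  have "mean j (\<lambda>P. if P ! i then 0 else c) = mean j (\<lambda>P. if take (Suc i) P ! i then 0 else c)"
    by simp
  also have "\<dots> = mean (Suc i) (\<lambda>P. if P ! i then 0 else c)"
    using mean_take[of "Suc i" j "\<lambda>P. if P ! i then 0 else c"] assms by simp
  also have "\<dots> = mean i (\<lambda>P. c / 2)"
    unfolding mean_snoc by (rule mean_cong) (simp add: nth_append)
  finally show ?thesis by simp
qed

lemma mean_degree_product_le:
  assumes ij: "i < j" "j < n"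
    and \<delta>: "mean (Suc i) (\<lambda>u. \<bar>dens u - \<alpha>\<bar>) \<le> \<delta>" "mean (Suc j) (\<lambda>u. \<bar>dens u - \<alpha>\<bar>) \<le> \<delta>"
  shows "mean n (\<lambda>x. fwd_degree n e i x * fwd_degree n e j x) \<le> \<alpha> ^ 3 / 16 + 2 * \<delta> + gap i j / 2"
proof -
  let ?F = "\<lambda>x. fwd_degree n e i x * fwd_degree n e j x"
  let ?Q = "\<lambda>P. take i P @ [True]"
  let ?G = "\<lambda>P. if P ! i then 0
     else cmean n (\<lambda>y. \<bar>bdeg y (P @ [False]) - bdeg y (P @ [True])\<bar>) (?Q P)"
  have "mean n ?F = mean (Suc j) (cmean n ?F)" using ij by (simp add: mean_cmean del: mean.simps)
  also have "\<dots> = mean j (\<lambda>P. (cmean n ?F (P @ [False]) + cmean n ?F (P @ [True])) / 2)"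
    by (rule mean_snoc)
  also have "\<dots> \<le> mean j (\<lambda>P. ((if P ! i then 0 else \<alpha> ^ 3 / 4) + \<bar>dens (?Q P) - \<alpha>\<bar>
        + \<bar>dens (P @ [True]) - \<alpha>\<bar> + ?G P) / 2)"
  proof (rule mean_mono)
    fix P :: "bool list" assume P: "length P = j"
    have "cmean n ?F (P @ [True]) = cmean n (\<lambda>_. 0) (P @ [True])"
      by (rule cmean_cong) (use P in \<open>simp add: fwd_degree_def nth_append\<close>)
    then have 1: "cmean n ?F (P @ [True]) = 0" by (simp add: cmean_def)
    have 2: "cmean n ?F (P @ [False]) \<le> (if P ! i then 0 else \<alpha> ^ 3 / 4) + \<bar>dens (?Q P) - \<alpha>\<bar>
        + \<bar>dens (P @ [True]) - \<alpha>\<bar> + ?G P"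
    proof (cases "P ! i")
      case True
      have "cmean n ?F (P @ [False]) = cmean n (\<lambda>_. 0) (P @ [False])"
        by (rule cmean_cong) (use P ij True in \<open>simp add: fwd_degree_def nth_append\<close>)
      then show ?thesis using True by (simp add: cmean_def)
    next
      case False
      then show ?thesis using degree_product_local[of i P] P ij by simp
    qed
    show "(cmean n ?F (P @ [False]) + cmean n ?F (P @ [True])) / 2
      \<le> ((if P ! i then 0 else \<alpha> ^ 3 / 4) + \<bar>dens (?Q P) - \<alpha>\<bar> + \<bar>dens (P @ [True]) - \<alpha>\<bar> + ?G P) / 2"
      using 1 2 by simp
  qed
  also have "\<dots> = (\<alpha> ^ 3 / 8 + mean i (\<lambda>u. \<bar>dens (u @ [True]) - \<alpha>\<bar>)
        + mean j (\<lambda>u. \<bar>dens (u @ [True]) - \<alpha>\<bar>) + gap i j) / 2"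
    using mean_take[of i j "\<lambda>u. \<bar>dens (u @ [True]) - \<alpha>\<bar>"] ij
    by (simp only: mean_divc mean_add mean_nth_False[OF ij(1)] gap_def) simp
  also have "\<dots> \<le> \<alpha> ^ 3 / 16 + 2 * \<delta> + gap i j / 2"
    using mean_right_child_le[OF \<delta>(1)] mean_right_child_le[OF \<delta>(2)] by simp
  finally show ?thesis .
qed

text \<open>
  For a fixed continuation \<open>z\<close> of \<open>y\<close> after position \<open>i\<close>, the adjacency to \<open>y\<close> is a function of
  \<open>x\<close> alone, because the first \<open>i\<close> digits of \<open>y\<close> are those of \<open>x\<close>. So the energy bound for the
  gaps between siblings applies. The parameter \<open>\<mu>\<close> turns squared gaps into gaps by
  \<open>t \<le> \<mu> + t\<^sup>2 / \<mu>\<close>.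
\<close>

lemma sum_gap_le:
  fixes \<mu> :: real
  assumes "i < n" "finite J" "J \<subseteq> {i<..<n}" "0 < \<mu>"
  shows "(\<Sum>j\<in>J. gap i j) \<le> card J * \<mu> + 4 / \<mu>"
proof -
  \<comment> \<open>The string \<open>take i x @ True # z\<close> is \<open>y\<close>, recovered from \<open>x\<close> and \<open>z\<close>.\<close>
  define F where "F z x = (if x ! i then 0 else of_bool (e x (take i x @ True # z)) :: real)" for z x
  have F: "0 \<le> F z x" "F z x \<le> 1" for z x by (auto simp: F_def)
  define sq where "sq z j = mean j (\<lambda>P. (cmean n (F z) (P @ [False]) - cmean n (F z) (P @ [True]))\<^sup>2)" for z j
  have gap: "gap i j \<le> \<mu> + mean (n - Suc i) (\<lambda>z. sq z j) / \<mu>" if "i < j" for j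
  proof -
    have FP: "cmean n (F z) (P @ [c]) = (if P ! i then 0 else bdeg (take i P @ True # z) (P @ [c]))"
      if "length P = j" for z P c
    proof -
      have "cmean n (F z) (P @ [c])
          = cmean n (\<lambda>x. if P ! i then 0 else of_bool (e x (take i P @ True # z))) (P @ [c])"
        by (rule cmean_cong) (use that \<open>i < j\<close> in \<open>simp add: F_def nth_append\<close>)
      then show ?thesis by (simp add: cmean_def)
    qed
    have "gap i j = mean j (\<lambda>P. mean (n - Suc i)
        (\<lambda>z. \<bar>cmean n (F z) (P @ [False]) - cmean n (F z) (P @ [True])\<bar>))"
      unfolding gap_def
    proof (rule mean_cong)
      fix P :: "bool list" assume "length P = j"
      then show "(if P ! i then 0
           else cmean n (\<lambda>y. \<bar>bdeg y (P @ [False]) - bdeg y (P @ [True])\<bar>) (take i P @ [True]))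
         = mean (n - Suc i) (\<lambda>z. \<bar>cmean n (F z) (P @ [False]) - cmean n (F z) (P @ [True])\<bar>)"
        using \<open>i < j\<close> by (simp add: FP) (simp add: cmean_def[of n _ "take i P @ [True]"])
    qed
    also have "\<dots> \<le> mean j (\<lambda>P. mean (n - Suc i)
        (\<lambda>z. \<mu> + (cmean n (F z) (P @ [False]) - cmean n (F z) (P @ [True]))\<^sup>2 / \<mu>))"
    proof (intro mean_mono)
      fix P z
      let ?t = "cmean n (F z) (P @ [False]) - cmean n (F z) (P @ [True])"
      have "0 \<le> (\<bar>?t\<bar> - \<mu>)\<^sup>2" by simp
      then have "\<mu> * \<bar>?t\<bar> * 2 \<le> \<mu>\<^sup>2 + ?t\<^sup>2"
        by (simp add: power2_diff algebra_simps)
      moreover have "0 \<le> \<mu> * \<bar>?t\<bar>" using \<open>0 < \<mu>\<close> by simp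
      ultimately have "\<mu> * \<bar>?t\<bar> \<le> \<mu>\<^sup>2 + ?t\<^sup>2" by linarith
      then show "\<bar>?t\<bar> \<le> \<mu> + ?t\<^sup>2 / \<mu>"
        using \<open>0 < \<mu>\<close> by (simp add: field_simps power2_eq_square)
    qed
    also have "\<dots> = \<mu> + mean (n - Suc i) (\<lambda>z. sq z j) / \<mu>"
      by (simp add: mean_add mean_divc sq_def) (rule disjI2, rule mean_swap)
    finally show ?thesis .
  qed
  have "(\<Sum>j\<in>J. mean (n - Suc i) (\<lambda>z. sq z j)) = mean (n - Suc i) (\<lambda>z. \<Sum>j\<in>J. sq z j)"
    by (simp add: mean_sum)
  also have "\<dots> \<le> 4"
  proof (rule mean_le_const)
    fix z
    have "(\<Sum>j\<in>J. sq z j) \<le> (\<Sum>j<n. sq z j)"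
      by (rule sum_mono2) (use assms in \<open>auto simp: sq_def intro: mean_nonneg\<close>)
    also have "\<dots> \<le> 4" unfolding sq_def by (rule sum_sibling_gaps_le) (rule F)+
    finally show "(\<Sum>j\<in>J. sq z j) \<le> 4" .
  qed
  finally have *: "(\<Sum>j\<in>J. mean (n - Suc i) (\<lambda>z. sq z j)) \<le> 4" .
  have "(\<Sum>j\<in>J. gap i j) \<le> (\<Sum>j\<in>J. \<mu> + mean (n - Suc i) (\<lambda>z. sq z j) / \<mu>)"
    by (rule sum_mono) (use assms gap in auto)
  also have "\<dots> = card J * \<mu> + (\<Sum>j\<in>J. mean (n - Suc i) (\<lambda>z. sq z j)) / \<mu>"
    by (simp add: sum.distrib sum_divide_distrib)
  also have "\<dots> \<le> card J * \<mu> + 4 / \<mu>" using * \<open>0 < \<mu>\<close> by (simp add: divide_right_mono)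
  finally show ?thesis .
qed

text \<open>
  For \<open>\<mu>\<close> and \<open>\<delta>\<close> small and \<open>k\<close> large, the right-hand side is small compared to \<open>k\<^sup>2\<close>, so the
  average density of the levels in \<open>I\<close> hardly exceeds \<open>\<alpha>\<^sup>2 / 2\<close>, provided that \<open>\<alpha>\<close> is not too small. Both bounds
  come from the second moment of \<open>S\<close>, the sum of the forward degrees over the levels in \<open>I\<close>: from below by a
  tangent, from above by the bound for pairs of levels.
\<close>

lemma sum_tree_density_triangle_free:
  fixes \<mu> :: real
  assumes I: "finite I" "I \<subseteq> {..<n}"
    and \<delta>: "\<And>i. i \<in> I \<Longrightarrow> mean (Suc i) (\<lambda>u. \<bar>dens u - \<alpha>\<bar>) \<le> \<delta>" "0 \<le> \<delta>"
    and \<mu>: "0 < \<mu>"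
  defines "k \<equiv> real (card I)"
  shows "k * \<alpha> * ((\<Sum>i\<in>I. tree_density n e i) - k * \<alpha>\<^sup>2 / 2) / 4
     \<le> k + k\<^sup>2 * (2 * \<delta> + \<mu> / 2) + 4 * k / \<mu>"
proof -
  let ?d = "fwd_degree n e"
  define S where "S x = (\<Sum>i\<in>I. ?d i x)" for x
  \<comment> \<open>The mean of \<open>S\<close> on \<open>A\<close> in the extremal case: on each level, \<open>x\<close> goes to the left
    with probability \<open>1 / 2\<close> and then has forward degree \<open>\<alpha> / 2\<close>.\<close>
  define t where "t = k * \<alpha> / 4"
  define X where "X = (\<Sum>i\<in>I. tree_density n e i)"
  have meanS: "mean n S = X / 2"
    using I by (simp add: S_def[abs_def] X_def mean_sum sum_divide_distrib)
      (intro sum.cong refl, auto simp: mean_fwd_degree)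
  have "2 * t * mean n S - t\<^sup>2 * \<alpha> = mean n (\<lambda>x. 2 * t * S x - t\<^sup>2 * of_bool (a x))"
    by (simp add: mean_diff mean_cmult cmean_Nil)
  also have "\<dots> \<le> mean n (\<lambda>x. (S x)\<^sup>2)"
  proof (rule mean_mono)
    fix x
    show "2 * t * S x - t\<^sup>2 * of_bool (a x) \<le> (S x)\<^sup>2"
    proof (cases "a x")
      case True
      have "0 \<le> (S x - t)\<^sup>2" by simp
      then show ?thesis using True by (simp add: power2_diff algebra_simps)
    next
      case False
      then have "\<not> e x y" for y using verts by blast
      then have "?d i x = 0" for i by (simp add: fwd_degree_def cmean_def)
      then have "S x = 0" by (simp add: S_def)
      then show ?thesis by simp
    qed
  qed
  finally have lower: "2 * t * mean n S - t\<^sup>2 * \<alpha> \<le> mean n (\<lambda>x. (S x)\<^sup>2)" .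
  define c where "c = \<alpha> ^ 3 / 16 + 2 * \<delta>"
  have c: "0 \<le> c" using \<delta>(2) cmean_bounds(1)[of "\<lambda>x. of_bool (a x)" n "[]"] by (simp add: c_def)
  have pairs: "2 * (\<Sum>i\<in>I. real (card {j\<in>I. i < j})) \<le> k\<^sup>2"
    using power2_sum_eq_pairs[OF I(1), of "\<lambda>_. 1"] by (simp add: k_def)
  have "mean n (\<lambda>x. (S x)\<^sup>2)
      = (\<Sum>i\<in>I. mean n (\<lambda>x. (?d i x)\<^sup>2)) + 2 * (\<Sum>i\<in>I. \<Sum>j\<in>{j\<in>I. i < j}. mean n (\<lambda>x. ?d i x * ?d j x))"
    unfolding S_def power2_sum_eq_pairs[OF I(1)] by (simp add: mean_add mean_cmult mean_sum)
  also have "\<dots> \<le> (\<Sum>i\<in>I. 1) + 2 * (\<Sum>i\<in>I. card {j\<in>I. i < j} * (c + \<mu> / 2) + 2 / \<mu>)"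
  proof -
    have "mean n (\<lambda>x. (?d i x)\<^sup>2) \<le> 1" for i
      by (rule mean_le_const) (simp add: fwd_degree_bounds power_le_one)
    moreover have "(\<Sum>j\<in>{j\<in>I. i < j}. mean n (\<lambda>x. ?d i x * ?d j x))
        \<le> card {j\<in>I. i < j} * (c + \<mu> / 2) + 2 / \<mu>" if i: "i \<in> I" for i
    proof -
      have "(\<Sum>j\<in>{j\<in>I. i < j}. mean n (\<lambda>x. ?d i x * ?d j x)) \<le> (\<Sum>j\<in>{j\<in>I. i < j}. c + gap i j / 2)"
        unfolding c_def by (rule sum_mono, rule mean_degree_product_le) (use i I \<delta>(1) in auto)
      also have "\<dots> = card {j\<in>I. i < j} * c + (\<Sum>j\<in>{j\<in>I. i < j}. gap i j) / 2"
        by (simp add: sum.distrib sum_divide_distrib)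
      also have "\<dots> \<le> card {j\<in>I. i < j} * c + (card {j\<in>I. i < j} * \<mu> + 4 / \<mu>) / 2"
      proof -
        have "i < n" "finite {j\<in>I. i < j}" "{j\<in>I. i < j} \<subseteq> {i<..<n}" using i I by auto
        from sum_gap_le[OF this \<mu>] show ?thesis by simp
      qed
      finally show ?thesis by (simp add: algebra_simps add_divide_distrib)
    qed
    ultimately show ?thesis
      by (intro add_mono mult_left_mono sum_mono) auto
  qed
  also have "\<dots> = k + 2 * (\<Sum>i\<in>I. real (card {j\<in>I. i < j})) * (c + \<mu> / 2) + 4 * k / \<mu>"
    by (simp add: k_def sum.distrib sum_distrib_right sum_distrib_left mult.assoc)
  also have "\<dots> \<le> k + k\<^sup>2 * (c + \<mu> / 2) + 4 * k / \<mu>"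
    using pairs c \<mu> by (simp add: mult_right_mono)
  finally have "2 * t * (X / 2) - t\<^sup>2 * \<alpha> \<le> k + k\<^sup>2 * (c + \<mu> / 2) + 4 * k / \<mu>"
    using lower meanS by simp
  then show ?thesis
    unfolding X_def[symmetric] t_def c_def
    by (simp add: power2_eq_square power3_eq_cube algebra_simps)
qed

end

section \<open>Edges that drop a label\<close>

text \<open>
  For \<open>p = q = r\<close> this is the symmetry between \<open>i < j\<close> and \<open>j < i\<close>: both together have
  probability \<open>1 - (\<Sum>i\<in>I. (p i)\<^sup>2)\<close>.
\<close>

lemma ordered_pair_sum_le:
  fixes p q r :: "nat \<Rightarrow> real"
  assumes "finite I"
    and p: "\<And>i. 0 \<le> p i" "sum p I = 1"
    and q: "\<And>i. 0 \<le> q i" "sum q I = 1"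
  shows "(\<Sum>i\<in>I. \<Sum>j\<in>{j\<in>I. i < j}. r i * q j)
     \<le> (1 - (\<Sum>i\<in>I. (p i)\<^sup>2)) / 2 + (\<Sum>i\<in>I. \<bar>q i - p i\<bar>) + (\<Sum>i\<in>I. \<bar>r i - p i\<bar>)"
proof -
  let ?U = "\<lambda>i. {j\<in>I. i < j}"
  have "(\<Sum>j\<in>?U i. r i * q j) \<le> (\<Sum>j\<in>?U i. p i * p j) + p i * (\<Sum>j\<in>I. \<bar>q j - p j\<bar>) + \<bar>r i - p i\<bar>" for i
  proof -
    have "(\<Sum>j\<in>?U i. r i * q j) = (r i - p i) * sum q (?U i) + p i * (\<Sum>j\<in>?U i. q j - p j) + (\<Sum>j\<in>?U i. p i * p j)"
      by (simp add: sum_distrib_left sum_subtractf algebra_simps)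
    moreover have "(r i - p i) * sum q (?U i) \<le> \<bar>r i - p i\<bar>"
    proof -
      have "0 \<le> sum q (?U i)" by (rule sum_nonneg) (rule q)
      moreover have "sum q (?U i) \<le> sum q I"
        by (rule sum_mono2) (use assms in auto)
      ultimately show ?thesis using q(2)
        by (smt (verit) mult_left_le mult_right_mono)
    qed
    moreover have "p i * (\<Sum>j\<in>?U i. q j - p j) \<le> p i * (\<Sum>j\<in>I. \<bar>q j - p j\<bar>)"
    proof (rule mult_left_mono)
      have "(\<Sum>j\<in>?U i. q j - p j) \<le> (\<Sum>j\<in>?U i. \<bar>q j - p j\<bar>)" by (rule sum_mono) simp
      also have "\<dots> \<le> (\<Sum>j\<in>I. \<bar>q j - p j\<bar>)" by (rule sum_mono2) (use assms in auto)
      finally show "(\<Sum>j\<in>?U i. q j - p j) \<le> (\<Sum>j\<in>I. \<bar>q j - p j\<bar>)" .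
    qed (rule p)
    ultimately show ?thesis by linarith
  qed
  then have "(\<Sum>i\<in>I. \<Sum>j\<in>?U i. r i * q j)
      \<le> (\<Sum>i\<in>I. (\<Sum>j\<in>?U i. p i * p j) + p i * (\<Sum>j\<in>I. \<bar>q j - p j\<bar>) + \<bar>r i - p i\<bar>)"
    by (rule sum_mono)
  also have "\<dots> = (\<Sum>i\<in>I. \<Sum>j\<in>?U i. p i * p j) + (\<Sum>j\<in>I. \<bar>q j - p j\<bar>) + (\<Sum>i\<in>I. \<bar>r i - p i\<bar>)"
    using p(2) by (simp add: sum.distrib sum_distrib_right[symmetric])
  also have "(\<Sum>i\<in>I. \<Sum>j\<in>?U i. p i * p j) = (1 - (\<Sum>i\<in>I. (p i)\<^sup>2)) / 2"
    using power2_sum_eq_pairs[OF assms(1), of p] p(2) by simp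
  finally show ?thesis by simp
qed

lemma cmean_sum: "cmean n (\<lambda>x. \<Sum>i\<in>S. F i x) u = (\<Sum>i\<in>S. cmean n (F i) u)"
  by (simp add: cmean_def mean_sum)

lemma cmean_mono: "(\<And>x. F x \<le> G x) \<Longrightarrow> cmean n F u \<le> cmean n G u"
  by (simp add: cmean_def mean_mono)

lemma sum_of_bool_member: "finite S \<Longrightarrow> (\<Sum>c\<in>S. of_bool (t = c)) = (of_bool (t \<in> S) :: real)"
  by (simp add: of_bool_def)

text \<open>
  In the two halves of a subtree the labels of \<open>x\<close> and \<open>y\<close> are independent with nearly the same
  distribution \<open>p\<close>, so \<open>f y < f x\<close> has probability at most \<open>(1 - (p b)\<^sup>2) / 2\<close> up to a small error.
\<close>

lemma tree_density_label_le:
  fixes f :: "bool list \<Rightarrow> nat" and n b :: nat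
  assumes edge: "\<And>x y. e x y \<Longrightarrow> f y < f x \<or> f x = b \<and> f y = b"
    and f: "\<And>x. f x \<le> b"
  defines "p \<equiv> \<lambda>c. cmean n (\<lambda>x. of_bool (f x = c))"
  assumes \<delta>: "\<And>c. c \<le> b \<Longrightarrow> mean (Suc i) (\<lambda>u. \<bar>p c u - p c []\<bar>) \<le> \<delta>"
  shows "tree_density n e i \<le> tree_density n (\<lambda>x y. e x y \<and> f x = b \<and> f y = b) i
     + (1 - (p b [])\<^sup>2) / 2 + 2 * (real b + 1) * \<delta>"
proof -
  let ?eA = "\<lambda>x y. e x y \<and> f x = b \<and> f y = b"
  let ?Z = "\<lambda>h u. cmean n (\<lambda>x. cmean n (\<lambda>y. h x y) (u @ [True])) (u @ [False]) :: real"
  let ?g = "\<lambda>u. \<Sum>c\<le>b. \<bar>p c u - p c []\<bar>"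
  let ?s = "(1 - (p b [])\<^sup>2) / 2"
  have p0: "0 \<le> p c u" for c u by (simp add: p_def cmean_bounds)
  have p1: "(\<Sum>c\<le>b. p c u) = 1" for u
    unfolding p_def by (simp only: cmean_sum[symmetric] sum_of_bool_member[OF finite_atMost])
      (simp add: f cmean_def)
  have "tree_density n e i \<le> mean i (\<lambda>u. ?Z (\<lambda>x y. of_bool (?eA x y)) u + ?s + (?g (u @ [False]) + ?g (u @ [True])))"
    unfolding tree_density_def
  proof (rule mean_mono)
    fix u
    have "?Z (\<lambda>x y. of_bool (e x y)) u \<le> ?Z (\<lambda>x y. of_bool (?eA x y)
        + (\<Sum>c\<le>b. \<Sum>c'\<in>{c'\<in>{..b}. c < c'}. of_bool (f y = c) * of_bool (f x = c'))) u"
    proof (intro cmean_mono)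
      fix x y
      have nn: "0 \<le> (\<Sum>c\<le>b. \<Sum>c'\<in>{c'\<in>{..b}. c < c'}. of_bool (f y = c) * of_bool (f x = c') :: real)"
        by (intro sum_nonneg) simp
      show "of_bool (e x y) \<le> of_bool (?eA x y)
        + (\<Sum>c\<le>b. \<Sum>c'\<in>{c'\<in>{..b}. c < c'}. of_bool (f y = c) * of_bool (f x = c') :: real)"
      proof (cases "e x y \<and> \<not> ?eA x y")
        case True
        then have "f y < f x" using edge[of x y] by auto
        have "(1::real) = (\<Sum>c'\<in>{f x}. of_bool (f y = f y) * of_bool (f x = c'))" by simp
        also have "\<dots> \<le> (\<Sum>c'\<in>{c'\<in>{..b}. f y < c'}. of_bool (f y = f y) * of_bool (f x = c'))"
          by (rule sum_mono2) (use \<open>f y < f x\<close> f in auto)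
        also have "\<dots> \<le> (\<Sum>c\<le>b. \<Sum>c'\<in>{c'\<in>{..b}. c < c'}. of_bool (f y = c) * of_bool (f x = c'))"
          by (rule member_le_sum[where f = "\<lambda>c. \<Sum>c'\<in>{c'\<in>{..b}. c < c'}. of_bool (f y = c) * of_bool (f x = c')"])
            (use f in \<open>auto intro: sum_nonneg\<close>)
        finally show ?thesis using True by simp
      next
        case False
        then show ?thesis using nn by auto
      qed
    qed
    also have "\<dots> = ?Z (\<lambda>x y. of_bool (?eA x y)) u
        + (\<Sum>c\<le>b. \<Sum>c'\<in>{c'\<in>{..b}. c < c'}. p c (u @ [True]) * p c' (u @ [False]))"
      unfolding p_def by (simp only: cmean_def mean_add mean_sum mean_multc mean_cmult)
    also have "(\<Sum>c\<le>b. \<Sum>c'\<in>{c'\<in>{..b}. c < c'}. p c (u @ [True]) * p c' (u @ [False]))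
        \<le> (1 - (\<Sum>c\<le>b. (p c [])\<^sup>2)) / 2 + ?g (u @ [False]) + ?g (u @ [True])"
      by (rule ordered_pair_sum_le) (simp_all add: p0 p1)
    also have "(1 - (\<Sum>c\<le>b. (p c [])\<^sup>2)) / 2 \<le> ?s"
      using member_le_sum[of b "{..b}" "\<lambda>c. (p c [])\<^sup>2"] by simp
    finally show "?Z (\<lambda>x y. of_bool (e x y)) u
        \<le> ?Z (\<lambda>x y. of_bool (?eA x y)) u + ?s + (?g (u @ [False]) + ?g (u @ [True]))"
      by simp
  qed
  also have "\<dots> = tree_density n ?eA i + ?s + 2 * mean (Suc i) ?g"
    unfolding mean_snoc tree_density_def by (simp add: mean_add mean_divc)
  also have "mean (Suc i) ?g \<le> (\<Sum>c\<le>b. \<delta>)"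
    unfolding mean_sum by (rule sum_mono) (use \<delta> in simp)
  finally show ?thesis by (simp add: algebra_simps)
qed

lemma tree_density_le_vertices:
  assumes "i < n" and "\<And>x y. e x y \<Longrightarrow> a x"
  shows "tree_density n e i \<le> 2 * mean n (\<lambda>x. of_bool (a x))"
proof -
  have "mean n (fwd_degree n e i) \<le> mean n (\<lambda>x. of_bool (a x))"
  proof (rule mean_mono)
    fix x
    show "fwd_degree n e i x \<le> of_bool (a x)"
    proof (cases "a x")
      case True
      then show ?thesis by (simp add: fwd_degree_bounds)
    next
      case False
      then have "\<not> e x y" for y using assms(2) by blast
      then show ?thesis by (simp add: fwd_degree_def cmean_def)
    qed
  qed
  then show ?thesis using mean_fwd_degree[OF assms(1), of e] by simp
qed

section \<open>Combining both kinds of edges\<close>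

text \<open>
  The label part contributes at most \<open>(1 - \<alpha>\<^sup>2) / 2\<close> and the triangle-free part \<open>\<alpha>\<^sup>2 / 2\<close>, up to errors. If the
  sum were too large, the second part would exceed its bound by an average of \<open>3 * \<epsilon> / 8\<close>; this forces
  \<open>\<alpha> \<ge> 3 * \<epsilon> / 16\<close>, since the level density inside \<open>A\<close> is at most \<open>2 * \<alpha>\<close>. The excess then contradicts the bound for
  triangle-free graphs, used with \<open>\<mu> = \<epsilon>\<^sup>2 / 64\<close>.
\<close>

lemma sum_tree_density_less:
  fixes f :: "bool list \<Rightarrow> nat" and \<epsilon> \<delta> :: real
  assumes edge: "\<And>x y. e x y \<Longrightarrow> f y < f x \<or> f x = b \<and> f y = b"
    and f: "\<And>x. f x \<le> b"
    and triangle: "\<And>x w y. x < w \<Longrightarrow> w < y \<Longrightarrow> e x w \<Longrightarrow> e w y \<Longrightarrow> e x y \<Longrightarrow> f y < b"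
    and I: "finite I" "I \<subseteq> {..<n}"
    and \<epsilon>: "0 < \<epsilon>" and k: "512 * (1 + 256 / \<epsilon>\<^sup>2) < real (card I) * \<epsilon>\<^sup>2"
    and \<delta>: "0 \<le> \<delta>" "16 * (real b + 1) * \<delta> \<le> \<epsilon>" "512 * \<delta> \<le> \<epsilon>\<^sup>2"
    and stable: "\<And>c i. c \<le> b \<Longrightarrow> i \<in> I \<Longrightarrow> mean (Suc i)
       (\<lambda>u. \<bar>cmean n (\<lambda>x. of_bool (f x = c)) u - cmean n (\<lambda>x. of_bool (f x = c)) []\<bar>) \<le> \<delta>"
  shows "(\<Sum>i\<in>I. tree_density n e i) < card I * (1 / 2 + \<epsilon> / 2)"
proof (rule ccontr)
  assume large: "\<not> ?thesis"
  define k where "k = real (card I)"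
  define \<alpha> where "\<alpha> = cmean n (\<lambda>x. of_bool (f x = b)) []"
  let ?eA = "\<lambda>x y. e x y \<and> f x = b \<and> f y = b"
  define X where "X = (\<Sum>i\<in>I. tree_density n ?eA i)"
  have kpos: "0 < k"
  proof (rule ccontr)
    assume "\<not> 0 < k"
    then have "real (card I) * \<epsilon>\<^sup>2 = 0" by (simp add: k_def)
    moreover
    have "0 \<le> 512 * (1 + 256 / \<epsilon>\<^sup>2)"
      by (intro mult_nonneg_nonneg add_nonneg_nonneg) auto
    then have "0 < real (card I) * \<epsilon>\<^sup>2" using k by (rule order.strict_trans1)
    ultimately show False by (metis less_irrefl)
  qed
  have "k * (1 / 2 + \<epsilon> / 2) \<le> (\<Sum>i\<in>I. tree_density n e i)"
    using large by (simp add: k_def)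
  also have "\<dots> \<le> (\<Sum>i\<in>I. tree_density n ?eA i + (1 - \<alpha>\<^sup>2) / 2 + 2 * (real b + 1) * \<delta>)"
    unfolding \<alpha>_def by (intro sum_mono tree_density_label_le edge f stable)
  also have "\<dots> = X + k * ((1 - \<alpha>\<^sup>2) / 2 + 2 * (real b + 1) * \<delta>)"
    by (simp add: X_def k_def sum.distrib algebra_simps)
  also have "\<dots> \<le> X + k * ((1 - \<alpha>\<^sup>2) / 2 + \<epsilon> / 8)"
    using kpos \<delta>(2) by (intro add_left_mono mult_left_mono) (auto simp: algebra_simps)
  finally have X: "k * (3 * \<epsilon> / 8) \<le> X - k * \<alpha>\<^sup>2 / 2"
    by (simp add: algebra_simps diff_divide_distrib add_divide_distrib)
  have "X \<le> (\<Sum>i\<in>I. 2 * \<alpha>)"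
    unfolding X_def \<alpha>_def cmean_Nil
    by (intro sum_mono tree_density_le_vertices) (use I in auto)
  then have "X \<le> k * (2 * \<alpha>)" by (simp add: k_def)
  moreover have "0 \<le> k * \<alpha>\<^sup>2 / 2" using kpos by simp
  ultimately have "k * (3 * \<epsilon> / 8) \<le> k * (2 * \<alpha>)" using X by linarith
  then have \<alpha>: "3 * \<epsilon> / 16 \<le> \<alpha>" using kpos by simp
  have "k * (3 * \<epsilon> / 16) * (k * (3 * \<epsilon> / 8)) / 4 \<le> k * \<alpha> * (X - k * \<alpha>\<^sup>2 / 2) / 4"
    using kpos \<alpha> X \<epsilon> by (intro divide_right_mono mult_mono) auto
  also have "\<dots> \<le> k + k\<^sup>2 * (2 * \<delta> + (\<epsilon>\<^sup>2 / 64) / 2) + 4 * k / (\<epsilon>\<^sup>2 / 64)"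
    unfolding k_def \<alpha>_def X_def
  proof (rule sum_tree_density_triangle_free[OF _ _ I])
    show "\<not> ?eA x y" if "x < w" "w < y" "?eA x w" "?eA w y" for x w y
      using triangle[of x w y] that by auto
  qed (use stable \<epsilon> \<delta> in auto)
  also have "\<dots> \<le> k + k\<^sup>2 * (6 * \<epsilon>\<^sup>2 / 512) + 256 * k / \<epsilon>\<^sup>2"
  proof -
    have "2 * \<delta> + (\<epsilon>\<^sup>2 / 64) / 2 \<le> 6 * \<epsilon>\<^sup>2 / 512" using \<delta>(3) by simp
    then have "k\<^sup>2 * (2 * \<delta> + (\<epsilon>\<^sup>2 / 64) / 2) \<le> k\<^sup>2 * (6 * \<epsilon>\<^sup>2 / 512)"
      by (intro mult_left_mono) auto
    then show ?thesis by simp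
  qed
  finally have "k * (k * \<epsilon>\<^sup>2 * 3 / 512) \<le> k * (1 + 256 / \<epsilon>\<^sup>2)"
    by (simp add: power2_eq_square algebra_simps)
  then have "k * \<epsilon>\<^sup>2 * 3 \<le> 512 * (1 + 256 / \<epsilon>\<^sup>2)" using kpos by simp
  also have "\<dots> < k * \<epsilon>\<^sup>2" unfolding k_def by (rule k)
  finally show False using mult_pos_pos[OF kpos, of "\<epsilon>\<^sup>2"] \<epsilon> by simp
qed

section \<open>A subtree with stable label densities\<close>

lemma cmean_append: "cmean d F (v @ w) = cmean (d - length v) (\<lambda>x. F (v @ x)) w"
  by (simp add: cmean_def)

lemma tree_density_append:
  "tree_density d e (m + i) = mean m (\<lambda>v. tree_density (d - m) (\<lambda>x y. e (v @ x) (v @ y)) i)"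
  unfolding tree_density_def mean_append
  by (intro mean_cong) (simp add: cmean_append)

lemma tree_density_le_1: "tree_density n e i \<le> 1"
  unfolding tree_density_def cmean_def by (intro mean_le_const) simp

lemma cmean_variance:
  assumes "r \<le> n"
  shows "mean r (\<lambda>w. (cmean n F w - cmean n F [])\<^sup>2)
     = mean r (\<lambda>w. (cmean n F w)\<^sup>2) - (cmean n F [])\<^sup>2"
  using mean_cmean[OF assms, of F]
  by (simp add: power2_diff mean_add mean_diff mean_multc mean_cmult cmean_Nil del: mean.simps)
     (simp add: power2_eq_square)

lemma pigeonhole_increment:
  fixes \<Phi> :: "nat \<Rightarrow> real"
  assumes "0 < K" "\<Phi> K - \<Phi> 0 \<le> c"
  shows "\<exists>t<K. \<Phi> (Suc t) - \<Phi> t \<le> c / K"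
proof (rule ccontr)
  assume "\<not> ?thesis"
  then have "(\<Sum>t<K. c / K) < (\<Sum>t<K. \<Phi> (Suc t) - \<Phi> t)"
    using assms(1) by (intro sum_strict_mono) auto
  then show False using assms by (simp add: sum_lessThan_telescope)
qed

text \<open>
  The \<open>K * k\<close> dense levels are cut into \<open>K\<close> blocks of length \<open>k\<close>. Along some block the total energy of the
  functions \<open>F c\<close> grows by at most \<open>card B / K\<close>. This increment is the average, over the vertices \<open>v\<close> at
  the depth where the block starts, of the variance \<open>V v\<close> of the conditional means below \<open>v\<close>. As
  \<open>K\<close> is large, subtracting \<open>V v / \<delta>\<^sup>2\<close> from the average density below \<open>v\<close> costs at most \<open>\<eta>\<close> on
  average, and any \<open>v\<close> that is at least average for this difference has both properties: its
  levels are dense, and its variance is at most \<open>\<delta>\<^sup>2\<close>, since densities are at most 1.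
\<close>

lemma exists_stable_subtree:
  fixes F :: "'c \<Rightarrow> bool list \<Rightarrow> real" and j :: "nat \<Rightarrow> nat" and \<delta> \<eta> t :: real
  assumes "finite B" and F: "\<And>c x. 0 \<le> F c x" "\<And>c x. F c x \<le> 1"
    and j: "strict_mono_on {..K * k} j" "j (K * k) \<le> d"
    and dense: "\<And>s. s < K * k \<Longrightarrow> t \<le> tree_density d e (j s)"
    and K: "card B \<le> K * (\<delta>\<^sup>2 * \<eta>)" "0 < K" and k: "0 < k"
    and \<delta>: "0 < \<delta>" and \<eta>: "0 \<le> \<eta>" "\<eta> \<le> t"
  shows "\<exists>m v I. m \<le> d \<and> length v = m \<and> I \<subseteq> {..<d - m} \<and> card I = k
     \<and> k * (t - \<eta>) \<le> (\<Sum>i\<in>I. tree_density (d - m) (\<lambda>x y. e (v @ x) (v @ y)) i)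
     \<and> (\<forall>c\<in>B. \<forall>i\<in>I. mean (Suc i) (\<lambda>u. \<bar>cmean (d - m) (\<lambda>x. F c (v @ x)) u
           - cmean (d - m) (\<lambda>x. F c (v @ x)) []\<bar>) \<le> \<delta>)"
proof -
  have less: "j s < j s'" if "s < s'" "s' \<le> K * k" for s s'
    using strict_mono_onD[OF j(1), of s s'] that by auto
  have le_d: "j s \<le> d" if "s \<le> K * k" for s
    using less[of s "K * k"] that j(2) by (cases "s = K * k") auto
  define \<Phi> where "\<Phi> m = (\<Sum>c\<in>B. mean m (\<lambda>u. (cmean d (F c) u)\<^sup>2))" for m
  have "\<Phi> (j (K * k)) - \<Phi> (j (0 * k)) \<le> card B"
  proof -
    have "mean m (\<lambda>u. (cmean d (F c) u)\<^sup>2) \<le> 1" for m c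
      by (rule mean_le_const) (simp add: cmean_bounds F power_le_one)
    then have "\<Phi> (j (K * k)) \<le> (\<Sum>c\<in>B. 1)" unfolding \<Phi>_def by (intro sum_mono)
    moreover have "0 \<le> \<Phi> (j (0 * k))"
      unfolding \<Phi>_def by (intro sum_nonneg mean_nonneg) simp
    ultimately show ?thesis by simp
  qed
  from pigeonhole_increment[of K "\<lambda>q. \<Phi> (j (q * k))", OF K(2) this]
  obtain q where q: "q < K" and inc: "\<Phi> (j (Suc q * k)) - \<Phi> (j (q * k)) \<le> card B / K"
    by blast
  have qk: "Suc q * k \<le> K * k" using q by (intro mult_right_mono) auto
  define m where "m = j (q * k)"
  define m' where "m' = j (Suc q * k)"
  define r where "r = m' - m"
  define T where "T = {q * k..<Suc q * k}"
  define I where "I = (\<lambda>s. j s - m) ` T"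
  have m': "m < m'" "m' \<le> d"
    unfolding m_def m'_def using less[of "q * k" "Suc q * k"] k qk le_d by auto
  have T: "m \<le> j s \<and> j s < m' \<and> s < K * k" if "s \<in> T" for s
  proof -
    have s: "q * k \<le> s" "s < Suc q * k" using that by (auto simp: T_def)
    have "m \<le> j s"
      unfolding m_def using less[of "q * k" s] s qk by (cases "s = q * k") auto
    moreover have "j s < m'" unfolding m'_def by (rule less[OF s(2) qk])
    ultimately show ?thesis using s qk by simp
  qed
  have inj: "inj_on (\<lambda>s. j s - m) T"
  proof (rule inj_onI)
    fix s s' assume s: "s \<in> T" "s' \<in> T" "j s - m = j s' - m"
    then have "j s = j s'" using T[of s] T[of s'] by linarith
    then show "s = s'"
      using less[of s s'] less[of s' s] T[of s] T[of s'] s by (cases s s' rule: linorder_cases) auto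
  qed
  have cardI: "card I = k" unfolding I_def using card_image[OF inj] by (simp add: T_def)
  have I_r: "i < r" if "i \<in> I" for i
    using that T unfolding I_def r_def by fastforce
  let ?D = "\<lambda>v. \<Sum>i\<in>I. tree_density (d - m) (\<lambda>x y. e (v @ x) (v @ y)) i"
  let ?p = "\<lambda>v c. cmean (d - m) (\<lambda>x. F c (v @ x))"
  define V where "V v = (\<Sum>c\<in>B. mean r (\<lambda>w. (?p v c w - ?p v c [])\<^sup>2))" for v
  have meanD: "k * t \<le> mean m ?D"
  proof -
    have "k * t = (\<Sum>s\<in>T. t)" by (simp add: T_def)
    also have "\<dots> \<le> (\<Sum>s\<in>T. tree_density d e (m + (j s - m)))"
      using T dense by (intro sum_mono) simp
    also have "\<dots> = (\<Sum>i\<in>I. tree_density d e (m + i))"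
      unfolding I_def by (simp add: sum.reindex[OF inj])
    also have "\<dots> = mean m ?D" by (simp add: tree_density_append mean_sum)
    finally show ?thesis .
  qed
  have rn: "r \<le> d - m" using m' by (simp add: r_def)
  have meanV: "mean m V \<le> card B / K"
  proof -
    have "mean m V = (\<Sum>c\<in>B. mean m (\<lambda>v. mean r (\<lambda>w. (?p v c w)\<^sup>2)) - mean m (\<lambda>v. (?p v c [])\<^sup>2))"
      unfolding V_def[abs_def] by (simp add: mean_sum cmean_variance[OF rn] mean_diff)
    also have "\<dots> = \<Phi> (m + r) - \<Phi> m"
      unfolding \<Phi>_def sum_subtractf[symmetric]
    proof (rule sum.cong[OF refl])
      fix c
      have "mean m (\<lambda>v. mean r (\<lambda>w. (?p v c w)\<^sup>2)) = mean (m + r) (\<lambda>u. (cmean d (F c) u)\<^sup>2)"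
        unfolding mean_append by (intro mean_cong) (simp add: cmean_append)
      moreover have "mean m (\<lambda>v. (?p v c [])\<^sup>2) = mean m (\<lambda>u. (cmean d (F c) u)\<^sup>2)"
        by (rule mean_cong) (simp add: cmean_def)
      ultimately show "mean m (\<lambda>v. mean r (\<lambda>w. (?p v c w)\<^sup>2)) - mean m (\<lambda>v. (?p v c [])\<^sup>2)
        = mean (m + r) (\<lambda>u. (cmean d (F c) u)\<^sup>2) - mean m (\<lambda>u. (cmean d (F c) u)\<^sup>2)" by simp
    qed
    also have "\<dots> \<le> card B / K" using inc m' by (simp add: r_def m_def m'_def)
    finally show ?thesis .
  qed
  have "card B / K \<le> \<delta>\<^sup>2 * \<eta>" using K by (simp add: field_simps)
  with meanV have "mean m V / \<delta>\<^sup>2 \<le> \<eta>" using \<delta> by (simp add: field_simps)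
  then have "k * (mean m V / \<delta>\<^sup>2) \<le> k * \<eta>" by (intro mult_left_mono) simp_all
  then have "k * (t - \<eta>) \<le> mean m (\<lambda>v. ?D v - k * (V v / \<delta>\<^sup>2))"
    using meanD by (simp add: mean_diff mean_cmult mean_divc right_diff_distrib)
  \<comment> \<open>The factor \<open>1 / \<delta>\<^sup>2\<close> is chosen so that a variance above \<open>\<delta>\<^sup>2\<close> would make the difference negative.\<close>
  from mean_ge_witness[OF this] obtain v where v: "length v = m"
    and vD: "k * (t - \<eta>) \<le> ?D v - k * (V v / \<delta>\<^sup>2)" by blast
  have Vnn: "0 \<le> V v" unfolding V_def by (intro sum_nonneg mean_nonneg) simp
  then have "0 \<le> k * (V v / \<delta>\<^sup>2)" by simp
  with vD have D: "k * (t - \<eta>) \<le> ?D v" by linarith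
  have "?D v \<le> (\<Sum>i\<in>I. 1)" by (intro sum_mono tree_density_le_1)
  moreover have "0 \<le> k * (t - \<eta>)" using \<eta> by simp
  ultimately have "k * (V v / \<delta>\<^sup>2) \<le> (\<Sum>i\<in>I. 1)" using vD by linarith
  then have "k * (V v / \<delta>\<^sup>2) \<le> k * 1" by (simp add: cardI)
  then have V: "V v \<le> \<delta>\<^sup>2" using k \<delta> by (simp add: field_simps)
  have "mean (Suc i) (\<lambda>u. \<bar>?p v c u - ?p v c []\<bar>) \<le> \<delta>" if "c \<in> B" "i \<in> I" for c i
  proof (rule mean_abs_le)
    have "mean (Suc i) (\<lambda>u. (?p v c u - ?p v c [])\<^sup>2) \<le> mean r (\<lambda>u. (?p v c u - ?p v c [])\<^sup>2)"
      using mean_cmean_power2_mono[of "Suc i" r "d - m" "\<lambda>x. F c (v @ x)"] I_r[OF that(2)] rn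
      by (simp add: cmean_variance del: mean.simps)
    also have "\<dots> \<le> V v"
      unfolding V_def
      by (rule member_le_sum[where f = "\<lambda>c. mean r (\<lambda>u. (?p v c u - ?p v c [])\<^sup>2)"])
        (use that \<open>finite B\<close> in \<open>auto intro: mean_nonneg\<close>)
    finally show "mean (Suc i) (\<lambda>u. (?p v c u - ?p v c [])\<^sup>2) \<le> \<delta>\<^sup>2" using V by simp
  qed (use \<delta> in simp)
  moreover have "I \<subseteq> {..<d - m}" using I_r rn by fastforce
  moreover have "m \<le> d" using m' by simp
  ultimately show ?thesis using v cardI D by blast
qed

section \<open>Counting edges by levels\<close>

lemma level_density_eq_tree_density:
  assumes "i < d"
  shows "level_density (Suc i) d E = tree_density d (\<lambda>x y. x < y \<and> {x, y} \<in> E) i"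
proof -
  let ?N = "d - Suc i"
  let ?L = "\<lambda>n. {x :: bool list. length x = n}"
  let ?f = "\<lambda>(u, v, w). (u @ False # v, u @ True # w :: bool list)"
  let ?S = "?L i \<times> ?L ?N \<times> ?L ?N"
  let ?P = "\<lambda>s. case ?f s of (x, y) \<Rightarrow> {x, y} \<in> E"
  have fin: "finite (?L n)" for n using finite_lists_length_eq[of "UNIV :: bool set" n] by simp
  have inj: "inj_on ?f {s \<in> ?S. ?P s}" by (auto simp: inj_on_def)
  have pairs: "level_pairs (Suc i) d = ?f ` ?S"
    using level_pairs_eq[of "Suc i" d] assms by simp
  have "level_edges (Suc i) d E = card (?f ` {s \<in> ?S. ?P s})"
  proof -
    have "{(x, y). (x, y) \<in> f ` S \<and> {x, y} \<in> E} = f ` {s \<in> S. case f s of (x, y) \<Rightarrow> {x, y} \<in> E}"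
      for f :: "'s \<Rightarrow> bool list \<times> bool list" and S by force
    then show ?thesis unfolding level_edges_def pairs by (rule arg_cong)
  qed
  also have "\<dots> = card {s \<in> ?S. ?P s}" by (rule card_image[OF inj])
  also have "real \<dots> = (\<Sum>s\<in>?S. of_bool (?P s))"
  proof -
    have gen: "real (card {s \<in> S. P s}) = (\<Sum>s\<in>S. of_bool (P s))" if "finite S" for S :: "'s set" and P
      using that by (simp add: Int_def)
    show ?thesis by (rule gen) (intro finite_cartesian_product fin)
  qed
  also have "\<dots> = (\<Sum>u\<in>?L i. \<Sum>v\<in>?L ?N. \<Sum>w\<in>?L ?N. of_bool ({u @ False # v, u @ True # w} \<in> E))"
    by (simp add: sum.cartesian_product case_prod_unfold)
  also have "\<dots> = 2 ^ i * 2 ^ ?N * 2 ^ ?N * tree_density d (\<lambda>x y. x < y \<and> {x, y} \<in> E) i"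
  proof -
    have "tree_density d (\<lambda>x y. x < y \<and> {x, y} \<in> E) i
        = mean i (\<lambda>u. mean ?N (\<lambda>v. mean ?N (\<lambda>w. of_bool ({u @ False # v, u @ True # w} \<in> E))))"
      unfolding tree_density_def
      by (rule mean_cong) (simp add: cmean_def append_False_less_append_True)
    then show ?thesis
      by (simp add: mean_eq_sum sum_divide_distrib[symmetric])
  qed
  finally have "real (level_edges (Suc i) d E)
    = 2 ^ i * 2 ^ ?N * 2 ^ ?N * tree_density d (\<lambda>x y. x < y \<and> {x, y} \<in> E) i" .
  moreover have "real (tau (Suc i) d) = 2 ^ i * 2 ^ ?N * 2 ^ ?N"
  proof -
    have exponent: "2 * d - Suc i - 1 = i + ?N + ?N" using assms by linarith
    have "tau (Suc i) d = 2 ^ (2 * d - Suc i - 1)" using tau_eq[of "Suc i" d] assms by simp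
    then show ?thesis by (simp only: exponent power_add) simp
  qed
  ultimately show ?thesis by (simp add: level_density_def)
qed

section \<open>Increasing paths and the target graph\<close>

fun starts_path :: "bool list set set \<Rightarrow> nat \<Rightarrow> bool list \<Rightarrow> bool" where
  "starts_path E 0 x \<longleftrightarrow> True"
| "starts_path E (Suc r) x \<longleftrightarrow> (\<exists>y. x < y \<and> {x, y} \<in> E \<and> starts_path E r y)"

lemma starts_path_antimono: "starts_path E r x \<Longrightarrow> q \<le> r \<Longrightarrow> starts_path E q x"
proof (induction r arbitrary: q x)
  case (Suc r)
  then show ?case by (cases q) auto
qed simp

lemma starts_path_obtain:
  assumes "starts_path E r x"
  shows "\<exists>p. p 0 = x \<and> (\<forall>i<r. p i < p (Suc i) \<and> {p i, p (Suc i)} \<in> E)"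
  using assms
proof (induction r arbitrary: x)
  case 0
  then show ?case by (intro exI[of _ "\<lambda>_. x"]) simp
next
  case (Suc r)
  then obtain y where y: "x < y" "{x, y} \<in> E" "starts_path E r y" by auto
  from Suc.IH[OF y(3)] obtain p where
    p: "p 0 = y" "\<And>i. i < r \<Longrightarrow> p i < p (Suc i) \<and> {p i, p (Suc i)} \<in> E" by blast
  have "case_nat x p i < case_nat x p (Suc i) \<and> {case_nat x p i, case_nat x p (Suc i)} \<in> E"
    if "i < Suc r" for i
    using that p y by (cases i) auto
  then show ?case by (intro exI[of _ "case_nat x p"]) simp
qed

definition path_label :: "bool list set set \<Rightarrow> nat \<Rightarrow> bool list \<Rightarrow> nat" where
  "path_label E b x = Max {r. r \<le> b \<and> starts_path E r x}"

lemma path_label: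
  shows path_label_le: "path_label E b x \<le> b"
    and starts_path_path_label: "starts_path E (path_label E b x) x"
    and path_label_ge: "r \<le> b \<Longrightarrow> starts_path E r x \<Longrightarrow> r \<le> path_label E b x"
proof -
  let ?R = "{r. r \<le> b \<and> starts_path E r x}"
  have fin: "finite ?R" by simp
  have "Max ?R \<in> ?R" by (rule Max_in[OF fin]) (auto intro!: exI[of _ 0])
  then show "path_label E b x \<le> b" "starts_path E (path_label E b x) x"
    by (simp_all add: path_label_def)
  show "r \<le> b \<Longrightarrow> starts_path E r x \<Longrightarrow> r \<le> path_label E b x"
    unfolding path_label_def by (rule Max_ge[OF fin]) simp
qed

text \<open>
  An edge prepended to a path makes it longer; only the cap at \<open>b\<close> can hide this.
\<close>

lemma path_label_edge:
  assumes "x < y" "{x, y} \<in> E"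
  shows "path_label E b y < path_label E b x \<or> path_label E b x = b \<and> path_label E b y = b"
proof -
  have step: "starts_path E (Suc (path_label E b y)) x"
    using assms starts_path_path_label by auto
  show ?thesis
  proof (cases "path_label E b y < b")
    case True
    then show ?thesis using path_label_ge[OF _ step, of b] by simp
  next
    case False
    then have y: "path_label E b y = b" using path_label_le[of E b y] by simp
    then have "b \<le> path_label E b x"
      using starts_path_antimono[OF step] by (intro path_label_ge) auto
    then show ?thesis using y path_label_le[of E b x] by simp
  qed
qed

lemma dense_levels_enumerate:
  assumes J: "finite J" "N < card J" and pos: "0 \<notin> J"
  shows "\<exists>j. strict_mono_on {..N} j \<and> (\<forall>s\<le>N. Suc (j s) \<in> J)"
proof (intro exI conjI allI impI)
  let ?l = "sorted_list_of_set J"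
  have len: "length ?l = card J" by simp
  have J_nth: "?l ! s \<in> J" if "s \<le> N" for s
    using that J len nth_mem[of s ?l] by simp
  have pos_nth: "0 < ?l ! s" if "s \<le> N" for s
    using J_nth[OF that] pos by (cases "?l ! s") auto
  show "Suc (?l ! s - 1) \<in> J" if "s \<le> N" for s
    using J_nth[OF that] pos_nth[OF that] by simp
  show "strict_mono_on {..N} (\<lambda>s. ?l ! s - 1)"
  proof (rule strict_mono_onI)
    fix s s' assume "s \<in> {..N}" "s' \<in> {..N}" "s < s'"
    moreover from this have "?l ! s < ?l ! s'"
      using sorted_wrt_nth_less[OF strict_sorted_list_of_set, of s s' J] J len by simp
    ultimately show "?l ! s - 1 < ?l ! s' - 1" using pos_nth[of s] by simp
  qed
qed

lemma contains_Q2I: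
  assumes E: "simple_graph V E"
    and x: "x1 < x2" "x2 < x3" "{x1, x2} \<in> E" "{x1, x3} \<in> E" "{x2, x3} \<in> E"
    and path: "starts_path E b x3"
  shows "contains_ordered_copy V E (Q2_verts b) (Q2_edges b)"
proof -
  from starts_path_obtain[OF path] obtain p where
    p: "p 0 = x3" "\<And>i. i < b \<Longrightarrow> p i < p (Suc i) \<and> {p i, p (Suc i)} \<in> E" by blast
  define g where "g i = (if i \<le> 1 then x1 else if i = 2 then x2 else p (i - 3))" for i
  have edge_V: "s \<in> V \<and> t \<in> V" if "{s, t} \<in> E" for s t
    using E that by (auto simp: simple_graph_def)
  have g3: "g (Suc (Suc (Suc i))) = p i" for i by (simp add: g_def eval_nat_numeral)
  have step: "g i < g (Suc i) \<and> {g i, g (Suc i)} \<in> E" if i: "1 \<le> i" "i < b + 3" for i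
  proof -
    consider "i = 1" | "i = 2" | j where "i = Suc (Suc (Suc j))" "j < b"
    proof -
      assume c: "i = 1 \<Longrightarrow> thesis" "i = 2 \<Longrightarrow> thesis"
        "\<And>j. i = Suc (Suc (Suc j)) \<Longrightarrow> j < b \<Longrightarrow> thesis"
      show thesis
      proof (cases "i \<le> 2")
        case True
        then show ?thesis using i c by (cases "i = 1") auto
      next
        case False
        then show ?thesis using i by (intro c(3)[of "i - 3"]) auto
      qed
    qed
    then show ?thesis
    proof cases
      case 3
      then show ?thesis using p(2)[of j] by (simp only: g3)
    qed (use x p(1) in \<open>auto simp: g_def eval_nat_numeral\<close>)
  qed
  have less: "g i < g j" if "1 \<le> i" "i < j" "j \<le> b + 3" for i j
    using that(2,3,1)
  proof (induction j)
    case (Suc j)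
    show ?case
    proof (cases "i = j")
      case True
      then show ?thesis using step[of i] Suc.prems by simp
    next
      case False
      then have "g i < g j" using Suc by simp
      also have "g j < g (Suc j)" using step[of j] Suc.prems by simp
      finally show ?thesis .
    qed
  qed simp
  have "ordered_copy g (Q2_verts b) (Q2_edges b) V E"
    unfolding ordered_copy_def
  proof (intro conjI ballI)
    show "g ` Q2_verts b \<subseteq> V"
    proof
      fix z assume "z \<in> g ` Q2_verts b"
      then obtain i where i: "1 \<le> i" "i \<le> b + 3" "z = g i" by (auto simp: Q2_verts_def)
      then show "z \<in> V"
        using edge_V[of "g i" "g (Suc i)"] edge_V[of "g (i - 1)" "g i"] step[of i] step[of "i - 1"]
        by (cases "i = 1") auto
    qed
    show "inj_on g (Q2_verts b)"
    proof (rule inj_onI)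
      fix i j assume "i \<in> Q2_verts b" "j \<in> Q2_verts b" "g i = g j"
      then show "i = j"
        using less[of i j] less[of j i] by (cases i j rule: linorder_cases) (auto simp: Q2_verts_def)
    qed
    show "mono_on (Q2_verts b) g"
    proof (rule mono_onI)
      fix i j assume "i \<in> Q2_verts b" "j \<in> Q2_verts b" "i \<le> j"
      then show "g i \<le> g j"
        using less[of i j] by (cases "i = j") (auto simp: Q2_verts_def)
    qed
    fix s assume "s \<in> Q2_edges b"
    then consider "s = {1, 2}" | "s = {1, 3}" | "s = {2, 3}"
      | i where "s = {i, i + 1}" "3 \<le> i" "i \<le> b + 2"
      by (auto simp: Q2_edges_def)
    then show "g ` s \<in> E"
    proof cases
      case 4
      then show ?thesis using step[of i] by simp
    qed (use x p(1) in \<open>auto simp: g_def insert_commute\<close>)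
  qed
  then show ?thesis by (auto simp: contains_ordered_copy_def)
qed

section \<open>The density bound\<close>

theorem theorem8p1:
  fixes b :: nat and \<epsilon> :: real
  assumes "b \<ge> 1" and "\<epsilon> > 0"
  shows "\<exists>C::nat. \<forall>d\<ge>1. \<forall>E. simple_graph (binary_interval d) E \<longrightarrow>
           C \<le> card {l \<in> {1..d}. level_density l d E \<ge> 1 / 2 + \<epsilon>} \<longrightarrow>
           contains_ordered_copy (binary_interval d) E (Q2_verts b) (Q2_edges b)"
proof -
  define \<delta> where "\<delta> = min (\<epsilon> / (16 * (real b + 1))) (\<epsilon>\<^sup>2 / 512)"
  have \<delta>: "0 < \<delta>" "16 * (real b + 1) * \<delta> \<le> \<epsilon>" "512 * \<delta> \<le> \<epsilon>\<^sup>2"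
  proof -
    have b: "0 < 16 * (real b + 1)" by simp
    have "\<delta> \<le> \<epsilon> / (16 * (real b + 1))" by (simp only: \<delta>_def min.cobounded1)
    then show "16 * (real b + 1) * \<delta> \<le> \<epsilon>"
      unfolding pos_le_divide_eq[OF b] by (simp add: mult.commute)
    have "\<delta> \<le> \<epsilon>\<^sup>2 / 512" by (simp only: \<delta>_def min.cobounded2)
    then show "512 * \<delta> \<le> \<epsilon>\<^sup>2" by simp
    show "0 < \<delta>" using assms(2) by (simp add: \<delta>_def)
  qed
  obtain k0 :: nat where "512 * (1 + 256 / \<epsilon>\<^sup>2) / \<epsilon>\<^sup>2 < k0" using reals_Archimedean2 by blast
  then have k0: "512 * (1 + 256 / \<epsilon>\<^sup>2) / \<epsilon>\<^sup>2 < Suc k0" by simp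
  define k where "k = Suc k0"
  have k: "512 * (1 + 256 / \<epsilon>\<^sup>2) < real k * \<epsilon>\<^sup>2" "0 < k"
    using k0 assms(2) by (simp_all add: k_def pos_divide_less_eq)
  obtain K0 :: nat where "(real b + 1) / (\<delta>\<^sup>2 * (\<epsilon> / 2)) < K0" using reals_Archimedean2 by blast
  then have K0: "(real b + 1) / (\<delta>\<^sup>2 * (\<epsilon> / 2)) \<le> Suc K0" by simp
  define K where "K = Suc K0"
  have K: "real (card {..b}) \<le> K * (\<delta>\<^sup>2 * (\<epsilon> / 2))" "0 < K"
  proof -
    have "0 < \<delta>\<^sup>2 * (\<epsilon> / 2)" using \<delta> assms(2) by simp
    from K0[unfolded pos_divide_le_eq[OF this]] show "real (card {..b}) \<le> K * (\<delta>\<^sup>2 * (\<epsilon> / 2))"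
      by (simp add: K_def)
  qed (simp add: K_def)
  show ?thesis
  proof (intro exI[of _ "Suc (K * k)"] allI impI)
    fix d E
    assume E: "simple_graph (binary_interval d) E"
      and many: "Suc (K * k) \<le> card {l \<in> {1..d}. level_density l d E \<ge> 1 / 2 + \<epsilon>}"
    show "contains_ordered_copy (binary_interval d) E (Q2_verts b) (Q2_edges b)"
    proof (rule ccontr)
      assume no_copy: "\<not> ?thesis"
      let ?e = "\<lambda>x y. x < y \<and> {x, y} \<in> E"
      let ?f = "path_label E b"
      let ?J = "{l \<in> {1..d}. level_density l d E \<ge> 1 / 2 + \<epsilon>}"
      obtain j where j: "strict_mono_on {..K * k} j" and jJ: "\<And>s. s \<le> K * k \<Longrightarrow> Suc (j s) \<in> ?J"
        using dense_levels_enumerate[of ?J "K * k"] many by auto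
      \<comment> \<open>Half of the excess \<open>\<epsilon>\<close> is given up to find a subtree with stable label densities.\<close>
      have "\<exists>m v I. m \<le> d \<and> length v = m \<and> I \<subseteq> {..<d - m} \<and> card I = k
        \<and> k * (1 / 2 + \<epsilon> - \<epsilon> / 2) \<le> (\<Sum>i\<in>I. tree_density (d - m) (\<lambda>x y. ?e (v @ x) (v @ y)) i)
        \<and> (\<forall>c\<in>{..b}. \<forall>i\<in>I. mean (Suc i) (\<lambda>u.
             \<bar>cmean (d - m) (\<lambda>x. of_bool (?f (v @ x) = c)) u
              - cmean (d - m) (\<lambda>x. of_bool (?f (v @ x) = c)) []\<bar>) \<le> \<delta>)"
      proof (rule exists_stable_subtree[OF _ _ _ j _ _ K k(2) \<delta>(1)])
        show "j (K * k) \<le> d" using jJ[of "K * k"] by simp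
        show "1 / 2 + \<epsilon> \<le> tree_density d ?e (j s)" if "s < K * k" for s
          using jJ[of s] that level_density_eq_tree_density[of "j s" d E] by simp
      qed (use assms(2) in auto)
      then obtain m v I where I: "I \<subseteq> {..<d - m}" "card I = k"
        and dense: "k * (1 / 2 + \<epsilon> - \<epsilon> / 2) \<le> (\<Sum>i\<in>I. tree_density (d - m) (\<lambda>x y. ?e (v @ x) (v @ y)) i)"
        and stable: "\<And>c i. c \<le> b \<Longrightarrow> i \<in> I \<Longrightarrow> mean (Suc i) (\<lambda>u.
             \<bar>cmean (d - m) (\<lambda>x. of_bool (?f (v @ x) = c)) u
              - cmean (d - m) (\<lambda>x. of_bool (?f (v @ x) = c)) []\<bar>) \<le> \<delta>"
        by blast
      have "(\<Sum>i\<in>I. tree_density (d - m) (\<lambda>x y. ?e (v @ x) (v @ y)) i) < card I * (1 / 2 + \<epsilon> / 2)"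
      proof (rule sum_tree_density_less[where f = "\<lambda>x. ?f (v @ x)" and b = b and \<delta> = \<delta>])
        show "?f (v @ y) < ?f (v @ x) \<or> ?f (v @ x) = b \<and> ?f (v @ y) = b"
          if "?e (v @ x) (v @ y)" for x y
          using path_label_edge that by blast
        show "?f (v @ y) < b" if "?e (v @ x) (v @ w)" "?e (v @ w) (v @ y)" "?e (v @ x) (v @ y)" for x w y
        proof (rule ccontr)
          assume "\<not> ?f (v @ y) < b"
          then have "?f (v @ y) = b" using path_label_le[of E b "v @ y"] by simp
          then have "starts_path E b (v @ y)" using starts_path_path_label[of E b "v @ y"] by simp
          then show False using contains_Q2I[OF E, of "v @ x" "v @ w" "v @ y" b] that no_copy by blast
        qed
        show "finite I" using I(1) finite_subset by blast
      qed (use I k \<delta> assms stable path_label_le in auto)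
      then show False using dense I by (simp add: algebra_simps)
    qed
  qed
qed

end
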